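(* For $K>0$, the capacity $C(W,K)$ of the channel ensemble generated with $W$ satisfies \[ C(W,K)=\max\{C(W),\ H_{\max}(W)-K\}, \] where $C(W)$ is the Shannon capacity of the discrete memoryless channel $W$ and $H_{\max}(W)=\max_P H(T)$, the maximum over input distributions $P$ of the entropy of the output distribution $T(y)=\sum_x P(x)W(y|x)$.
   Context: Channel model: $\mathcal{X},\mathcal{Y}$ finite alphabets, $W(y|x)$ a fixed conditional distribution. For rate $R>0$, a codebook $\mathcal{C}_n$ consists of $\lfloor e^{nR}\rfloor$ codewords $\mathbf{x}_m\in\mathcal{X}^n$. A channel instance: independently for each message $m$, a cloud of $\lfloor e^{nK}\rfloor$ independent sequences $\mathbf{y}\in\mathcal{Y}^n$ whose letters are independent with $y_i\sim W(\cdot|x_{m,i})$. Messages are equiprobable; when $m$ is sent, the output is a uniformly chosen vector of the cloud of $m$. The decoder knows codebook and clouds; the ML decoder outputs a message whose cloud contains the most copies of the received vector (ties broken at random). $P_e(\mathcal{C}_n)$ is the ML error probability averaged over messages and channel instances. $C(W,K)$ is defined as the supremum of rates $R$ for which there exists a sequence of codebooks $\mathcal{C}_n$ of size $\lfloor e^{nR}\rfloor$ with $P_e(\mathcal{C}_n)\to 0$ as $n\to\infty$. Entropies and logs are natural (nats). *)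

theory Defs
  imports Complex_Main "HOL-Library.FuncSet"
begin

text \<open>Channels: input alphabet 'a, output alphabet 'b, both finite types.
  A channel W is given by W x y = W(y|x).  Sequences of length n are
  functions nat => _ whose values at positions i < n matter.\<close>

definition stochastic_channel :: "('a::finite \<Rightarrow> 'b::finite \<Rightarrow> real) \<Rightarrow> bool" where
  "stochastic_channel W \<longleftrightarrow> (\<forall>x y. 0 \<le> W x y) \<and> (\<forall>x. (\<Sum>y\<in>UNIV. W x y) = 1)"

definition input_dists :: "('a::finite \<Rightarrow> real) set" where
  "input_dists = {P. (\<forall>x. 0 \<le> P x) \<and> (\<Sum>x\<in>UNIV. P x) = 1}"

definition out_dist :: "('a::finite \<Rightarrow> real) \<Rightarrow> ('a \<Rightarrow> 'b \<Rightarrow> real) \<Rightarrow> 'b \<Rightarrow> real" where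
  "out_dist P W y = (\<Sum>x\<in>UNIV. P x * W x y)"

definition entropy_fin :: "('b::finite \<Rightarrow> real) \<Rightarrow> real" where
  "entropy_fin T = - (\<Sum>y\<in>UNIV. if T y = 0 then 0 else T y * ln (T y))"

definition mutual_info :: "('a::finite \<Rightarrow> real) \<Rightarrow> ('a \<Rightarrow> 'b::finite \<Rightarrow> real) \<Rightarrow> real" where
  "mutual_info P W = (\<Sum>x\<in>UNIV. \<Sum>y\<in>UNIV.
      if P x * W x y = 0 then 0 else P x * W x y * ln (W x y / out_dist P W y))"

definition shannon_capacity :: "('a::finite \<Rightarrow> 'b::finite \<Rightarrow> real) \<Rightarrow> real" where
  "shannon_capacity W = (SUP P\<in>input_dists. mutual_info P W)"

definition H_max :: "('a::finite \<Rightarrow> 'b::finite \<Rightarrow> real) \<Rightarrow> real" where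
  "H_max W = (SUP P\<in>input_dists. entropy_fin (out_dist P W))"

definition num_of :: "real \<Rightarrow> nat \<Rightarrow> nat" where
  "num_of r n = nat \<lfloor>exp (real n * r)\<rfloor>"

definition seqs :: "nat \<Rightarrow> (nat \<Rightarrow> 'b) set" where
  "seqs n = PiE {..<n} (\<lambda>_. UNIV)"

text \<open>Channel instances: for each message m < M and cloud index j < N a
  sequence Y (m,j) of length n.\<close>
definition instances :: "nat \<Rightarrow> nat \<Rightarrow> nat \<Rightarrow> (nat \<times> nat \<Rightarrow> nat \<Rightarrow> 'b) set" where
  "instances n M N = PiE ({..<M} \<times> {..<N}) (\<lambda>_. seqs n)"

text \<open>Probability of a channel instance, for codebook c (codeword of message m is
  c m, letter i is c m i): all cloud sequences independent, letters independent
  with y_i ~ W(.|c m i).\<close>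
definition inst_prob :: "('a \<Rightarrow> 'b \<Rightarrow> real) \<Rightarrow> nat \<Rightarrow> nat \<Rightarrow> nat \<Rightarrow> (nat \<Rightarrow> nat \<Rightarrow> 'a)
     \<Rightarrow> (nat \<times> nat \<Rightarrow> nat \<Rightarrow> 'b) \<Rightarrow> real" where
  "inst_prob W n M N c Y = (\<Prod>mj\<in>{..<M} \<times> {..<N}. \<Prod>i<n. W (c (fst mj) i) (Y mj i))"

definition copies :: "nat \<Rightarrow> (nat \<times> nat \<Rightarrow> nat \<Rightarrow> 'b) \<Rightarrow> nat \<Rightarrow> (nat \<Rightarrow> 'b) \<Rightarrow> nat" where
  "copies N Y m' y = card {j. j < N \<and> Y (m', j) = y}"

text \<open>Probability that the ML decoder (maximum number of copies, ties broken
  uniformly at random) outputs message m when the received vector is y.\<close>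
definition ml_correct :: "nat \<Rightarrow> nat \<Rightarrow> (nat \<times> nat \<Rightarrow> nat \<Rightarrow> 'b) \<Rightarrow> nat \<Rightarrow> (nat \<Rightarrow> 'b) \<Rightarrow> real" where
  "ml_correct M N Y m y =
     (let mx = Max ((\<lambda>m'. copies N Y m' y) ` {..<M});
          winners = {m'. m' < M \<and> copies N Y m' y = mx}
      in if copies N Y m y = mx then 1 / real (card winners) else 0)"

text \<open>ML error probability of the codebook c (M messages, block length n,
  cloud size N), averaged over messages, the uniformly chosen cloud element,
  and channel instances.\<close>
definition ml_error :: "('a::finite \<Rightarrow> 'b::finite \<Rightarrow> real) \<Rightarrow> nat \<Rightarrow> nat \<Rightarrow> nat
     \<Rightarrow> (nat \<Rightarrow> nat \<Rightarrow> 'a) \<Rightarrow> real" where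
  "ml_error W n M N c = 1 -
     (\<Sum>Y\<in>instances n M N. inst_prob W n M N c Y *
        (\<Sum>m<M. \<Sum>j<N. ml_correct M N Y m (Y (m, j)) / (real M * real N)))"

definition achievable :: "('a::finite \<Rightarrow> 'b::finite \<Rightarrow> real) \<Rightarrow> real \<Rightarrow> real \<Rightarrow> bool" where
  "achievable W K R \<longleftrightarrow> (\<exists>c :: nat \<Rightarrow> nat \<Rightarrow> nat \<Rightarrow> 'a.
      (\<lambda>n. ml_error W n (num_of R n) (num_of K n) (c n)) \<longlonglongrightarrow> 0)"

definition ensemble_capacity :: "('a::finite \<Rightarrow> 'b::finite \<Rightarrow> real) \<Rightarrow> real \<Rightarrow> real" where
  "ensemble_capacity W K =
     (if {R. 0 < R \<and> achievable W K R} = {} then 0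
      else Sup {R. 0 < R \<and> achievable W K R})"

end

theory Submission
  imports Defs "HOL-Analysis.Analysis"
begin

text \<open>Achievability is random coding with i.i.d. letters.  Below the mutual information the clouds
  can be ignored and the usual likelihood-ratio test works.  Below \<open>H(T) - K\<close> the test
  ``the received word lies in the cloud of \<open>m\<close>'' works: a competing cloud element coincides with a
  typical received word with probability about \<open>exp (- n H(T))\<close>, and there are about
  \<open>exp (n (R + K))\<close> competitors.

  For the converse, the success probability is the expectation of the sum over \<open>y\<close> of the largest
  number of copies of \<open>y\<close> in a cloud, divided by \<open>M N\<close>.  The largest count is at most \<open>ln M\<close> plus
  twice the largest mean \<open>N W(y|x)\<close>; the first part, summed over typical \<open>y\<close>, gives
  \<open>H_max - K\<close>, and the second gives \<open>C(W)\<close>.  Instead of types, typicality is measured against the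
  output distributions of the entropy- and information-maximizing inputs; by the Kuhn-Tucker
  conditions, their mean log-likelihoods are controlled for every input letter at once.\<close>

subsection \<open>Product distributions on sequences\<close>

text \<open>The converse must hold for every codebook, and nothing is known about the composition of
  its codewords. At an entropy-maximizing input, \<open>H_max W\<close> bounds the mean of
  \<open>- ln (T y)\<close> given any letter \<open>x\<close>, even a letter of weight zero. So
  whatever the codeword, its output is typical for one fixed product law, with a Chernoff rate that
  depends on neither \<open>n\<close> nor the codeword. Typical outputs then number at most
  \<open>exp (n H)\<close>, and typical likelihoods are dominated by \<open>exp (n C)\<close> times
  a single probability law. Up to constant factors this bounds the two contributions to the success
  probability by \<open>exp (n H) * ln M / (M N)\<close> and \<open>exp (n C) / M\<close>.

  In the direct part the ML rule itself is never analysed: it does at least as well as any decoder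
  that sees the same clouds, so a test suited to the range of rates can take its place.\<close>

lemma sum_PiE_marginal:
  fixes p :: "'i \<Rightarrow> 'c \<Rightarrow> real"
  assumes "finite I" and fin: "\<And>i. i \<in> I \<Longrightarrow> finite (A i)"
    and one: "\<And>i. i \<in> I \<Longrightarrow> (\<Sum>a\<in>A i. p i a) = 1" and "k \<in> I"
  shows "(\<Sum>f\<in>PiE I A. (\<Prod>i\<in>I. p i (f i)) * g (f k)) = (\<Sum>a\<in>A k. p k a * g a)"
proof -
  have "(\<Prod>i\<in>I. p i (f i)) * g (f k) = (\<Prod>i\<in>I. p i (f i) * (if i = k then g (f i) else 1))" for f
    unfolding prod.distrib using assms by (simp add: prod.If_cases)
  then have "(\<Sum>f\<in>PiE I A. (\<Prod>i\<in>I. p i (f i)) * g (f k))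
      = (\<Prod>i\<in>I. \<Sum>a\<in>A i. p i a * (if i = k then g a else 1))"
    by (simp add: prod_sum_PiE[OF \<open>finite I\<close> fin])
  also have "\<dots> = (\<Prod>i\<in>I. if i = k then \<Sum>a\<in>A k. p k a * g a else 1)"
    by (intro prod.cong) (auto simp: one)
  finally show ?thesis using assms by simp
qed

text \<open>\<open>G\<close> need not factor over the two coordinates. Fixing the value
  \<open>a\<close> of \<open>f k\<close> writes it as a sum of terms \<open>u a\<close> that do, and
  each of these splits over the product.\<close>

lemma sum_PiE_marginal2:
  fixes p :: "'i \<Rightarrow> 'c \<Rightarrow> real"
  assumes "finite I" and fin: "\<And>i. i \<in> I \<Longrightarrow> finite (A i)"
    and one: "\<And>i. i \<in> I \<Longrightarrow> (\<Sum>a\<in>A i. p i a) = 1" and "k \<in> I" "l \<in> I" "k \<noteq> l"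
  shows "(\<Sum>f\<in>PiE I A. (\<Prod>i\<in>I. p i (f i)) * G (f k) (f l))
    = (\<Sum>a\<in>A k. \<Sum>b\<in>A l. p k a * p l b * G a b)"
proof -
  define u where "u a i b = (if i = k then if b = a then 1 else 0 else if i = l then G a b else 1)" for a i b
  have two: "(\<Prod>i\<in>I. if i = k then \<alpha> else if i = l then \<beta> else 1) = \<alpha> * \<beta>" for \<alpha> \<beta> :: real
  proof -
    have "(\<Prod>i\<in>I. if i = k then \<alpha> else if i = l then \<beta> else 1)
        = (\<Prod>i\<in>{k,l}. if i = k then \<alpha> else if i = l then \<beta> else 1)"
      using assms by (intro prod.mono_neutral_right) auto
    then show ?thesis using assms by simp
  qed
  have "(\<Prod>i\<in>I. p i (f i)) * G (f k) (f l) = (\<Sum>a\<in>A k. \<Prod>i\<in>I. p i (f i) * u a i (f i))"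
    if "f \<in> PiE I A" for f
  proof -
    have "(\<Prod>i\<in>I. u a i (f i)) = (if f k = a then 1 else 0) * G a (f l)" for a
    proof -
      have "(\<Prod>i\<in>I. u a i (f i))
        = (\<Prod>i\<in>I. if i = k then if f k = a then 1 else 0 else if i = l then G a (f l) else 1)"
        by (intro prod.cong) (auto simp: u_def)
      then show ?thesis unfolding two .
    qed
    moreover have "f k \<in> A k" using that assms by auto
    ultimately show ?thesis
      using fin[OF \<open>k \<in> I\<close>]
      by (simp add: prod.distrib if_distrib[of "\<lambda>z. z * _"] if_distrib[of "\<lambda>z. _ * z"] cong: if_cong)
  qed
  then have "(\<Sum>f\<in>PiE I A. (\<Prod>i\<in>I. p i (f i)) * G (f k) (f l))
      = (\<Sum>f\<in>PiE I A. \<Sum>a\<in>A k. \<Prod>i\<in>I. p i (f i) * u a i (f i))"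
    by (intro sum.cong) auto
  also have "\<dots> = (\<Sum>a\<in>A k. \<Sum>f\<in>PiE I A. \<Prod>i\<in>I. p i (f i) * u a i (f i))"
    by (rule sum.swap)
  also have "\<dots> = (\<Sum>a\<in>A k. \<Prod>i\<in>I. \<Sum>b\<in>A i. p i b * u a i b)"
    by (simp add: prod_sum_PiE[OF \<open>finite I\<close> fin])
  also have "\<dots> = (\<Sum>a\<in>A k. p k a * (\<Sum>b\<in>A l. p l b * G a b))"
  proof (intro sum.cong refl)
    fix a assume "a \<in> A k"
    have "(\<Prod>i\<in>I. \<Sum>b\<in>A i. p i b * u a i b)
      = (\<Prod>i\<in>I. if i = k then p k a else if i = l then \<Sum>b\<in>A l. p l b * G a b else 1)"
      using fin[OF \<open>k \<in> I\<close>] \<open>a \<in> A k\<close>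
      by (intro prod.cong) (auto simp: u_def one if_distrib[of "\<lambda>z. _ * z"] cong: if_cong)
    then show "(\<Prod>i\<in>I. \<Sum>b\<in>A i. p i b * u a i b) = p k a * (\<Sum>b\<in>A l. p l b * G a b)"
      unfolding two .
  qed
  finally show ?thesis by (simp add: sum_distrib_left mult.assoc)
qed

definition seq_prob :: "('a \<Rightarrow> 'b \<Rightarrow> real) \<Rightarrow> nat \<Rightarrow> (nat \<Rightarrow> 'a) \<Rightarrow> (nat \<Rightarrow> 'b) \<Rightarrow> real" where
  "seq_prob W n x y = (\<Prod>i<n. W (x i) (y i))"

definition iid_prob :: "('b \<Rightarrow> real) \<Rightarrow> nat \<Rightarrow> (nat \<Rightarrow> 'b) \<Rightarrow> real" where
  "iid_prob P n y = (\<Prod>i<n. P (y i))"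

lemma finite_seqs [simp]: "finite (seqs n :: (nat \<Rightarrow> 'b::finite) set)"
  by (simp add: seqs_def finite_PiE)

lemma sum_seqs_prod:
  "(\<Sum>y\<in>seqs n. \<Prod>i<n. f i (y i)) = (\<Prod>i<n. \<Sum>b\<in>UNIV. f i (b::'b::finite) :: real)"
  unfolding seqs_def by (subst prod_sum_PiE) auto

lemma seq_prob_nonneg: "stochastic_channel W \<Longrightarrow> 0 \<le> seq_prob W n x y"
  by (simp add: seq_prob_def stochastic_channel_def prod_nonneg)

lemma sum_seq_prob: "stochastic_channel W \<Longrightarrow> (\<Sum>y\<in>seqs n. seq_prob W n x y) = 1"
  using sum_seqs_prod[of "\<lambda>i. W (x i)" n] by (simp add: seq_prob_def stochastic_channel_def)

lemma iid_prob_nonneg: "P \<in> input_dists \<Longrightarrow> 0 \<le> iid_prob P n y"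
  by (simp add: iid_prob_def input_dists_def prod_nonneg)

lemma sum_iid_prob: "P \<in> input_dists \<Longrightarrow> (\<Sum>y\<in>seqs n. iid_prob P n y) = 1"
  using sum_seqs_prod[of "\<lambda>_. P" n] by (simp add: iid_prob_def input_dists_def)

lemma seq_prob_eq_0_iff: "seq_prob W n x y = 0 \<longleftrightarrow> (\<exists>i<n. W (x i) (y i) = 0)"
  by (auto simp: seq_prob_def)

lemma seq_prob_pos_iff:
  assumes "stochastic_channel W"
  shows "0 < seq_prob W n x y \<longleftrightarrow> (\<forall>i<n. 0 < W (x i) (y i))"
  using assms seq_prob_nonneg[OF assms, of n x y] seq_prob_eq_0_iff[of W n x y]
  by (auto simp: stochastic_channel_def less_le)

lemma ln_seq_prob:
  assumes "\<And>i. i < n \<Longrightarrow> 0 < W (x i) (y i)"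
  shows "ln (seq_prob W n x y) = (\<Sum>i<n. ln (W (x i) (y i)))"
  unfolding seq_prob_def using assms by (intro ln_prod) (auto simp: less_le)

lemma ln_iid_prob:
  assumes "\<And>i. i < n \<Longrightarrow> 0 < T (y i)"
  shows "0 < iid_prob T n y" "ln (iid_prob T n y) = (\<Sum>i<n. ln (T (y i)))"
proof -
  show "0 < iid_prob T n y" unfolding iid_prob_def using assms by (intro prod_pos) auto
  show "ln (iid_prob T n y) = (\<Sum>i<n. ln (T (y i)))"
    unfolding iid_prob_def using assms by (intro ln_prod) (auto simp: less_le)
qed

lemma out_dist_input_dists:
  fixes P :: "'a::finite \<Rightarrow> real" and W :: "'a \<Rightarrow> 'b::finite \<Rightarrow> real"
  assumes "P \<in> input_dists" "stochastic_channel W"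
  shows "out_dist P W \<in> input_dists"
proof -
  have "(\<Sum>y\<in>UNIV. out_dist P W y) = (\<Sum>x\<in>UNIV. P x * (\<Sum>y\<in>UNIV. W x y))"
    unfolding out_dist_def by (subst sum.swap) (simp add: sum_distrib_left)
  then show ?thesis
    using assms by (auto simp: input_dists_def stochastic_channel_def out_dist_def intro!: sum_nonneg)
qed

lemma sum_iid_seq_prob:
  "(\<Sum>x\<in>seqs n. iid_prob P n x * seq_prob W n x y) = iid_prob (out_dist P W) n y"
  using sum_seqs_prod[of "\<lambda>i x. P x * W x (y i)" n]
  by (simp add: iid_prob_def seq_prob_def prod.distrib out_dist_def)

section \<open>Exponential tail bounds\<close>

lemma exp_le_quadratic:
  fixes x :: real
  assumes "\<bar>x\<bar> \<le> 1/2"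
  shows "exp x \<le> 1 + x + 2 * x\<^sup>2"
proof -
  have "1 - x \<le> exp (-x)" using exp_ge_add_one_self[of "-x"] by simp
  then have "exp x * (1 - x) \<le> 1"
    using mult_left_mono[of "1 - x" "exp (-x)" "exp x"] by (simp add: exp_minus)
  moreover have "1 \<le> (1 + x + 2 * x\<^sup>2) * (1 - x)"
  proof -
    have "0 \<le> x\<^sup>2 * (1 - 2 * x)" using assms by (intro mult_nonneg_nonneg) auto
    then show ?thesis by (simp add: algebra_simps power2_eq_square)
  qed
  ultimately have "exp x * (1 - x) \<le> (1 + x + 2 * x\<^sup>2) * (1 - x)" by linarith
  then show ?thesis using assms by (simp add: mult_le_cancel_right)
qed

text \<open>Chernoff's argument: the moment generating function of \<open>g i\<close> is 1 at 0 and
  its slope there is the negative mean, so it drops below 1 for small \<open>s > 0\<close>. One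
  \<open>s\<close> and one \<rho> serve all indices because the index type is finite.\<close>

lemma exponential_tilt:
  fixes p g :: "'i::finite \<Rightarrow> 'j::finite \<Rightarrow> real"
  assumes nn: "\<And>i j. 0 \<le> p i j" and one: "\<And>i. (\<Sum>j\<in>UNIV. p i j) = 1"
    and neg: "\<And>i. (\<Sum>j\<in>UNIV. p i j * g i j) < 0"
  obtains s \<rho> where "0 < s" "0 \<le> \<rho>" "\<rho> < 1"
    "\<And>i. (\<Sum>j\<in>UNIV. p i j * exp (s * g i j)) \<le> \<rho>"
proof -
  define B where "B = 1 + (\<Sum>i\<in>UNIV. \<Sum>j\<in>UNIV. \<bar>g i j\<bar>)"
  have B1: "1 \<le> B" by (simp add: B_def sum_nonneg)
  have gB: "\<bar>g i j\<bar> \<le> B" for i j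
  proof -
    have "\<bar>g i j\<bar> \<le> (\<Sum>j\<in>UNIV. \<bar>g i j\<bar>)" by (rule member_le_sum) auto
    also have "\<dots> \<le> (\<Sum>i\<in>UNIV. \<Sum>j\<in>UNIV. \<bar>g i j\<bar>)"
      using member_le_sum[of i UNIV "\<lambda>i. \<Sum>j\<in>UNIV. \<bar>g i j\<bar>"] by (simp add: sum_nonneg)
    finally show ?thesis by (simp add: B_def)
  qed
  define e where "e = - Max (range (\<lambda>i. \<Sum>j\<in>UNIV. p i j * g i j))"
  have e: "0 < e" using neg by (simp add: e_def)
  have ge: "(\<Sum>j\<in>UNIV. p i j * g i j) \<le> - e" for i
    unfolding e_def minus_minus by (rule Max_ge) auto
  \<comment> \<open>The first bound keeps \<open>s * g i j\<close> in the range of the quadratic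
    estimate for \<open>exp\<close>; the second makes the quadratic term at most half of the linear
    gain \<open>s * e\<close>.\<close>
  define s where "s = min (1 / (2 * B)) (e / (4 * B\<^sup>2))"
  have s: "0 < s" "s \<le> 1 / (2 * B)" "s \<le> e / (4 * B\<^sup>2)"
    using B1 e unfolding s_def by auto
  have sB: "s * B \<le> 1/2" "2 * s * B\<^sup>2 \<le> e / 2"
    using s B1 by (auto simp: field_simps)
  have *: "(\<Sum>j\<in>UNIV. p i j * exp (s * g i j)) \<le> 1 - s * e / 2" for i
  proof -
    have "exp (s * g i j) \<le> 1 + s * g i j + 2 * s\<^sup>2 * B\<^sup>2" for j
    proof -
      have "\<bar>s * g i j\<bar> \<le> s * B" using gB s by (simp add: abs_mult)
      then have "exp (s * g i j) \<le> 1 + s * g i j + 2 * (s * g i j)\<^sup>2"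
        using sB by (intro exp_le_quadratic) linarith
      moreover have "(s * g i j)\<^sup>2 \<le> (s * B)\<^sup>2"
        using \<open>\<bar>s * g i j\<bar> \<le> s * B\<close> by (rule abs_le_square_iff[THEN iffD1, OF order_trans[OF _ abs_ge_self]])
      ultimately show ?thesis by (simp add: power_mult_distrib)
    qed
    then have "(\<Sum>j\<in>UNIV. p i j * exp (s * g i j))
        \<le> (\<Sum>j\<in>UNIV. p i j * (1 + s * g i j + 2 * s\<^sup>2 * B\<^sup>2))"
      by (intro sum_mono mult_left_mono nn)
    also have "\<dots> = (\<Sum>j\<in>UNIV. p i j) * (1 + 2 * s\<^sup>2 * B\<^sup>2) + s * (\<Sum>j\<in>UNIV. p i j * g i j)"
      by (simp add: sum_distrib_left sum_distrib_right sum.distrib[symmetric] algebra_simps)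
    also have "\<dots> \<le> 1 + s * (2 * s * B\<^sup>2) - s * e"
      using mult_left_mono[OF ge[of i], of s] s(1) by (simp add: one power2_eq_square algebra_simps)
    also have "\<dots> \<le> 1 - s * e / 2"
      using mult_left_mono[OF sB(2), of s] s(1) by (simp add: algebra_simps)
    finally show ?thesis .
  qed
  moreover have "0 \<le> 1 - s * e / 2"
    using order_trans[OF sum_nonneg *] nn by simp
  ultimately show ?thesis using s e by (intro that[of s "1 - s * e / 2"]) auto
qed

text \<open>Markov's inequality for the exponential of the sum, whose expectation factors over
  positions. The codeword \<open>x\<close> is arbitrary and \<rho> does not depend on it, as a
  converse over all codebooks requires.\<close>

lemma channel_tail:
  fixes W g :: "'a::finite \<Rightarrow> 'b::finite \<Rightarrow> real"
  assumes W: "stochastic_channel W" and neg: "\<And>x. (\<Sum>y\<in>UNIV. W x y * g x y) < 0"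
  obtains \<rho> where "0 \<le> \<rho>" "\<rho> < 1"
    "\<And>n x. (\<Sum>y\<in>seqs n. seq_prob W n x y * of_bool (0 \<le> (\<Sum>i<n. g (x i) (y i)))) \<le> \<rho> ^ n"
proof -
  obtain s \<rho> where s: "0 < s" "0 \<le> \<rho>" "\<rho> < 1" "\<And>x. (\<Sum>y\<in>UNIV. W x y * exp (s * g x y)) \<le> \<rho>"
    using exponential_tilt[of W g] W neg unfolding stochastic_channel_def by metis
  have "(\<Sum>y\<in>seqs n. seq_prob W n x y * of_bool (0 \<le> (\<Sum>i<n. g (x i) (y i)))) \<le> \<rho> ^ n" for n x
  proof -
    have "(\<Sum>y\<in>seqs n. seq_prob W n x y * of_bool (0 \<le> (\<Sum>i<n. g (x i) (y i))))
      \<le> (\<Sum>y\<in>seqs n. seq_prob W n x y * exp (s * (\<Sum>i<n. g (x i) (y i))))"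
      using s by (intro sum_mono mult_left_mono seq_prob_nonneg W) (simp add: of_bool_def)
    also have "\<dots> = (\<Prod>i<n. \<Sum>b\<in>UNIV. W (x i) b * exp (s * g (x i) b))"
      using sum_seqs_prod[of "\<lambda>i b. W (x i) b * exp (s * g (x i) b)" n]
      by (simp add: seq_prob_def sum_distrib_left exp_sum prod.distrib)
    also have "\<dots> \<le> (\<Prod>i<n. \<rho>)"
      using W by (intro prod_mono) (auto simp: s stochastic_channel_def intro!: sum_nonneg)
    finally show ?thesis by simp
  qed
  then show ?thesis using s by (intro that) auto
qed

lemma iid_tail:
  fixes P g :: "'b::finite \<Rightarrow> real"
  assumes P: "P \<in> input_dists" and neg: "(\<Sum>y\<in>UNIV. P y * g y) < 0"
  obtains \<rho> where "0 \<le> \<rho>" "\<rho> < 1"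
    "\<And>n. (\<Sum>y\<in>seqs n. iid_prob P n y * of_bool (0 \<le> (\<Sum>i<n. g (y i)))) \<le> \<rho> ^ n"
proof -
  have "stochastic_channel (\<lambda>_::unit. P)" using P by (simp add: stochastic_channel_def input_dists_def)
  from channel_tail[OF this, of "\<lambda>_. g"] neg that show ?thesis
    unfolding seq_prob_def iid_prob_def by auto
qed

text \<open>With a random input only the mean over pairs has to be negative, not the mean for each
  letter. Pairs are treated as one alphabet with law \<open>P x * W x y\<close>, under a one-element
  index type.\<close>

lemma joint_tail:
  fixes W g :: "'a::finite \<Rightarrow> 'b::finite \<Rightarrow> real"
  assumes W: "stochastic_channel W" and P: "P \<in> input_dists"
    and neg: "(\<Sum>x\<in>UNIV. \<Sum>y\<in>UNIV. P x * W x y * g x y) < 0"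
  obtains \<rho> where "0 \<le> \<rho>" "\<rho> < 1"
    "\<And>n. (\<Sum>x\<in>seqs n. \<Sum>y\<in>seqs n. iid_prob P n x * seq_prob W n x y *
        of_bool (0 \<le> (\<Sum>i<n. g (x i) (y i)))) \<le> \<rho> ^ n"
proof -
  define p where "p = (\<lambda>(_::unit) (x, y). P x * W x y)"
  have nn: "0 \<le> P x" "0 \<le> W x y" for x y
    using P W by (auto simp: input_dists_def stochastic_channel_def)
  have "0 \<le> p i j" for i j using nn by (auto simp: p_def split: prod.split)
  moreover have "(\<Sum>j\<in>UNIV. p i j) = 1" for i
    using P W unfolding p_def UNIV_Times_UNIV[symmetric] sum.cartesian_product[symmetric]
    by (simp add: input_dists_def stochastic_channel_def sum_distrib_left[symmetric])
  moreover have "(\<Sum>j\<in>UNIV. p i j * (\<lambda>_. \<lambda>(x,y). g x y) i j) < 0" for i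
    using neg unfolding p_def UNIV_Times_UNIV[symmetric]
    by (simp add: sum.cartesian_product case_prod_unfold)
  ultimately obtain s \<rho> where s: "0 < s" "0 \<le> \<rho>" "\<rho> < 1"
    and le: "\<And>i. (\<Sum>j\<in>UNIV. p i j * exp (s * (\<lambda>_. \<lambda>(x,y). g x y) i j)) \<le> \<rho>"
    using exponential_tilt[of p "\<lambda>_. \<lambda>(x,y). g x y"] by metis
  have le': "(\<Sum>x\<in>UNIV. \<Sum>y\<in>UNIV. P x * W x y * exp (s * g x y)) \<le> \<rho>"
    using le[of "()"] unfolding p_def UNIV_Times_UNIV[symmetric]
    by (simp add: sum.cartesian_product case_prod_unfold)
  have "(\<Sum>x\<in>seqs n. \<Sum>y\<in>seqs n. iid_prob P n x * seq_prob W n x y *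
        of_bool (0 \<le> (\<Sum>i<n. g (x i) (y i)))) \<le> \<rho> ^ n" for n
  proof -
    have "(\<Sum>x\<in>seqs n. \<Sum>y\<in>seqs n. iid_prob P n x * seq_prob W n x y *
        of_bool (0 \<le> (\<Sum>i<n. g (x i) (y i))))
      \<le> (\<Sum>x\<in>seqs n. \<Sum>y\<in>seqs n. iid_prob P n x * seq_prob W n x y * exp (s * (\<Sum>i<n. g (x i) (y i))))"
      using s by (intro sum_mono mult_left_mono mult_nonneg_nonneg seq_prob_nonneg iid_prob_nonneg W P)
        (simp add: of_bool_def)
    also have "\<dots> = (\<Sum>x\<in>seqs n. \<Prod>i<n. \<Sum>b\<in>UNIV. P (x i) * W (x i) b * exp (s * g (x i) b))"
    proof (intro sum.cong refl)
      fix x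
      show "(\<Sum>y\<in>seqs n. iid_prob P n x * seq_prob W n x y * exp (s * (\<Sum>i<n. g (x i) (y i))))
        = (\<Prod>i<n. \<Sum>b\<in>UNIV. P (x i) * W (x i) b * exp (s * g (x i) b))"
        using sum_seqs_prod[of "\<lambda>i b. P (x i) * W (x i) b * exp (s * g (x i) b)" n]
        by (simp add: seq_prob_def iid_prob_def sum_distrib_left exp_sum prod.distrib)
    qed
    also have "\<dots> = (\<Prod>i<n. \<Sum>x\<in>UNIV. \<Sum>y\<in>UNIV. P x * W x y * exp (s * g x y))"
      using sum_seqs_prod[of "\<lambda>i a. \<Sum>b\<in>UNIV. P a * W a b * exp (s * g a b)" n] by simp
    also have "\<dots> \<le> (\<Prod>i<n. \<rho>)"
      by (intro prod_mono conjI le' sum_nonneg) (simp add: nn)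
    finally show ?thesis by simp
  qed
  then show ?thesis using s by (intro that) auto
qed

subsection \<open>Entropy maximization over input distributions\<close>

lemma entropy_fin_eq: "entropy_fin T = (\<Sum>y\<in>UNIV. T y * (- ln (T y)))"
  unfolding entropy_fin_def sum_negf[symmetric] by (intro sum.cong) auto

text \<open>Only the point 0 needs work. The lower bound there is \<open>ln v \<le> v - 1\<close> at
  \<open>v = 1 / sqrt u\<close>; with \<open>v = 1 / u\<close> it would tend to -1 instead of
  0.\<close>

lemma continuous_on_mult_ln: "continuous_on {0::real..} (\<lambda>t. t * ln t)"
proof (rule continuous_on_eq_continuous_within[THEN iffD2], rule ballI)
  fix t :: real
  assume "t \<in> {0..}"
  show "continuous (at t within {0..}) (\<lambda>t. t * ln t)"
  proof (cases "t = 0")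
    case False
    then show ?thesis by (intro continuous_intros) auto
  next
    case True
    have lo: "2 * u - 2 * sqrt u \<le> u * ln u" if "0 \<le> u" for u :: real
    proof (cases "u = 0")
      case False
      then have "0 < u" using that by simp
      then have "- ln u / 2 = ln (1 / sqrt u)" by (simp add: ln_div ln_sqrt)
      also have "\<dots> \<le> 1 / sqrt u - 1" using \<open>0 < u\<close> by (intro ln_le_minus_one) simp
      finally have "u * (2 - 2 / sqrt u) \<le> u * ln u"
        using \<open>0 < u\<close> by (intro mult_left_mono) auto
      moreover have "u * (2 - 2 / sqrt u) = 2 * u - 2 * (u / sqrt u)" by (simp add: algebra_simps)
      ultimately show ?thesis using \<open>0 < u\<close> by (simp add: real_div_sqrt)
    qed simp
    have hi: "u * ln u \<le> u * (u - 1)" if "0 \<le> u" for u :: real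
      using that ln_le_minus_one[of u] by (cases "u = 0") (auto intro!: mult_left_mono)
    have "((\<lambda>u. u * ln u) \<longlongrightarrow> 0) (at (0::real) within {0..})"
    proof (rule tendsto_sandwich)
      show "\<forall>\<^sub>F u in at 0 within {0..}. 2 * u - 2 * sqrt u \<le> u * ln u"
        using lo by (auto simp: eventually_at_filter)
      show "\<forall>\<^sub>F u in at (0::real) within {0..}. u * ln u \<le> u * (u - 1)"
        using hi by (auto simp: eventually_at_filter)
      have "((\<lambda>u. 2 * u - 2 * sqrt u) \<longlongrightarrow> 2 * 0 - 2 * sqrt 0) (at 0 within {0..})"
        by (intro tendsto_intros)
      then show "((\<lambda>u::real. 2 * u - 2 * sqrt u) \<longlongrightarrow> 0) (at 0 within {0..})" by simp
      have "((\<lambda>u. u * (u - 1)) \<longlongrightarrow> 0 * (0 - 1)) (at (0::real) within {0..})"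
        by (intro tendsto_intros)
      then show "((\<lambda>u. u * (u - 1)) \<longlongrightarrow> 0) (at (0::real) within {0..})" by simp
    qed
    then show ?thesis by (simp add: True continuous_within)
  qed
qed

lemma input_dists_le_1:
  assumes "T \<in> input_dists" shows "0 \<le> T y" "T y \<le> (1::real)"
proof -
  show "0 \<le> T y" using assms by (simp add: input_dists_def)
  have "T y \<le> (\<Sum>y\<in>UNIV. T y)" using assms by (intro member_le_sum) (auto simp: input_dists_def)
  then show "T y \<le> 1" using assms by (simp add: input_dists_def)
qed

text \<open>Nonnegativity of relative entropy: \<open>ln v \<le> v - 1\<close> at
  \<open>v = S y / T y\<close> costs \<open>S y - T y\<close> per letter, and these differences
  cancel in the sum. The support condition excludes letters where the cross entropy ought to be
  infinite.\<close>

lemma gibbs: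
  fixes T S :: "'b::finite \<Rightarrow> real"
  assumes T: "T \<in> input_dists" and S: "S \<in> input_dists" and "\<And>y. 0 < T y \<Longrightarrow> 0 < S y"
  shows "entropy_fin T \<le> (\<Sum>y\<in>UNIV. T y * (- ln (S y)))"
proof -
  have "T y * (- ln (T y)) \<le> T y * (- ln (S y)) + (S y - T y)" for y
  proof (cases "T y = 0")
    case True then show ?thesis using input_dists_le_1[OF S, of y] by simp
  next
    case False
    then have "0 < T y" "0 < S y" using input_dists_le_1[OF T, of y] assms(3)[of y] by auto
    then have "ln (S y / T y) \<le> S y / T y - 1" by (intro ln_le_minus_one) simp
    then have "T y * (ln (S y) - ln (T y)) \<le> T y * (S y / T y - 1)"
      using \<open>0 < T y\<close> \<open>0 < S y\<close> by (intro mult_left_mono) (simp_all add: ln_div)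
    then show ?thesis using \<open>0 < T y\<close> by (simp add: algebra_simps)
  qed
  then have "entropy_fin T \<le> (\<Sum>y\<in>UNIV. T y * (- ln (S y)) + (S y - T y))"
    unfolding entropy_fin_eq by (intro sum_mono)
  also have "\<dots> = (\<Sum>y\<in>UNIV. T y * (- ln (S y)))"
    using T S unfolding sum.distrib sum_subtractf by (simp add: input_dists_def)
  finally show ?thesis .
qed

text \<open>The linear penalty covers both quantities of the theorem:
  \<open>L = (\<lambda>_. 0)\<close> leaves the output entropy, and
  \<open>L x = entropy_fin (W x)\<close> gives the mutual information. Maximizers and their
  optimality conditions are thus treated once.\<close>

definition penalized_entropy :: "('a::finite \<Rightarrow> 'b::finite \<Rightarrow> real) \<Rightarrow> ('a \<Rightarrow> real) \<Rightarrow> ('a \<Rightarrow> real) \<Rightarrow> real" where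
  "penalized_entropy W L P = entropy_fin (out_dist P W) - (\<Sum>x\<in>UNIV. P x * L x)"

lemma out_dist_pos:
  assumes "P \<in> input_dists" "stochastic_channel W" "0 < P x * W x y"
  shows "0 < out_dist P W y"
proof -
  have "P x * W x y \<le> out_dist P W y"
    unfolding out_dist_def using assms
    by (intro member_le_sum) (auto simp: input_dists_def stochastic_channel_def)
  then show ?thesis using assms by simp
qed

lemma mutual_info_eq:
  assumes P: "P \<in> input_dists" and W: "stochastic_channel W"
  shows "mutual_info P W = penalized_entropy W (\<lambda>x. entropy_fin (W x)) P"
proof -
  have "(if P x * W x y = 0 then 0 else P x * W x y * ln (W x y / out_dist P W y))
      = P x * W x y * ln (W x y) - P x * W x y * ln (out_dist P W y)" for x y
  proof (cases "P x * W x y = 0")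
    case False
    moreover have "0 \<le> P x" "0 \<le> W x y"
      using P W by (auto simp: input_dists_def stochastic_channel_def)
    ultimately have "0 < P x * W x y" "0 < W x y" by (auto simp: less_le)
    then have "0 < out_dist P W y" by (intro out_dist_pos[OF P W])
    then show ?thesis using False \<open>0 < W x y\<close> by (simp add: ln_div algebra_simps)
  qed auto
  then have "mutual_info P W = (\<Sum>x\<in>UNIV. \<Sum>y\<in>UNIV. P x * W x y * ln (W x y))
      - (\<Sum>x\<in>UNIV. \<Sum>y\<in>UNIV. P x * W x y * ln (out_dist P W y))"
    unfolding mutual_info_def by (simp add: sum_subtractf)
  also have "(\<Sum>x\<in>UNIV. \<Sum>y\<in>UNIV. P x * W x y * ln (out_dist P W y)) = - entropy_fin (out_dist P W)"
    unfolding entropy_fin_eq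
    by (subst sum.swap) (simp add: out_dist_def sum_distrib_right sum_negf)
  also have "(\<Sum>x\<in>UNIV. \<Sum>y\<in>UNIV. P x * W x y * ln (W x y)) = - (\<Sum>x\<in>UNIV. P x * entropy_fin (W x))"
    unfolding entropy_fin_eq by (simp add: sum_distrib_left sum_negf mult.assoc)
  finally show ?thesis by (simp add: penalized_entropy_def)
qed

section \<open>Maximizers and their optimality conditions\<close>

lemma penalized_entropy_attains_max:
  fixes W :: "'a::finite \<Rightarrow> 'b::finite \<Rightarrow> real"
  assumes W: "stochastic_channel W"
  obtains P where "P \<in> input_dists" "\<And>Q. Q \<in> input_dists \<Longrightarrow> penalized_entropy W L Q \<le> penalized_entropy W L P"
proof -
  \<comment> \<open>The probability simplex inside \<open>real^'a\<close>, where closed and bounded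
    give compact.\<close>
  define S where "S = {v :: real^'a. (\<forall>x. 0 \<le> v $ x) \<and> (\<Sum>x\<in>UNIV. v $ x) = 1}"
  have S: "v \<in> S \<longleftrightarrow> ($) v \<in> input_dists" for v by (simp add: S_def input_dists_def)
  have "closed S"
    unfolding S_def
    by (intro closed_Collect_conj closed_Collect_all closed_Collect_le closed_Collect_eq continuous_intros)
  moreover have "bounded S"
  proof -
    have "norm v \<le> 1" if "v \<in> S" for v
    proof -
      have "norm v \<le> (\<Sum>x\<in>UNIV. \<bar>v $ x\<bar>)" by (rule norm_le_l1_cart)
      also have "\<dots> = 1" using that by (simp add: S_def)
      finally show ?thesis .
    qed
    then show ?thesis unfolding bounded_iff by blast
  qed
  ultimately have "compact S" by (simp add: compact_eq_bounded_closed)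
  moreover have "axis undefined 1 \<in> S" by (simp add: S_def axis_def)
  moreover have "continuous_on S (\<lambda>v. penalized_entropy W L (($) v))"
  proof -
    have "continuous_on S (\<lambda>v. out_dist (($) v) W y * ln (out_dist (($) v) W y))" for y
    proof (rule continuous_on_compose2[OF continuous_on_mult_ln])
      show "continuous_on S (\<lambda>v. out_dist (($) v) W y)"
        unfolding out_dist_def by (intro continuous_intros)
      show "(\<lambda>v. out_dist (($) v) W y) ` S \<subseteq> {0..}"
        using input_dists_le_1(1)[OF out_dist_input_dists[OF _ W]] by (auto simp: S)
    qed
    then have "continuous_on S (\<lambda>v. entropy_fin (out_dist (($) v) W))"
      unfolding entropy_fin_eq mult_minus_right by (intro continuous_on_sum continuous_on_minus)
    then show ?thesis unfolding penalized_entropy_def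
      by (rule continuous_on_diff) (intro continuous_intros)
  qed
  ultimately obtain v where "v \<in> S" "\<And>w. w \<in> S \<Longrightarrow> penalized_entropy W L (($) w) \<le> penalized_entropy W L (($) v)"
    using continuous_attains_sup[of S "\<lambda>v. penalized_entropy W L (($) v)"] by blast
  moreover have "(\<chi> x. Q x) \<in> S" "($) (\<chi> x. Q x) = Q" if "Q \<in> input_dists" for Q :: "'a \<Rightarrow> real"
    using that by (auto simp: S_def input_dists_def)
  ultimately show ?thesis using S by (metis that)
qed

text \<open>Moving weight \<open>t\<close> from \<open>P\<close> to the letter \<open>x\<close>
  cannot increase the functional; dividing by \<open>t\<close> and letting \<open>t\<close> tend to
  0 gives the second claim. The entropy is not differentiated at \<open>P\<close>, since its slope
  is infinite where an output probability vanishes. The first claim ensures that the limit of the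
  logarithms is the right one.\<close>

lemma penalized_entropy_kkt:
  fixes W :: "'a::finite \<Rightarrow> 'b::finite \<Rightarrow> real"
  assumes W: "stochastic_channel W" and P: "P \<in> input_dists"
    and max: "\<And>Q. Q \<in> input_dists \<Longrightarrow> penalized_entropy W L Q \<le> penalized_entropy W L P"
  shows "0 < W x y \<Longrightarrow> 0 < out_dist P W y"
    and "(\<Sum>y\<in>UNIV. W x y * (- ln (out_dist P W y))) - L x \<le> penalized_entropy W L P"
proof -
  define T where "T = out_dist P W"
  define F where "F = penalized_entropy W L P"
  define S where "S t y = (1 - t) * T y + t * W x y" for t y
  have Wnn: "0 \<le> W x y" for x y using W by (simp add: stochastic_channel_def)
  have Wd: "W x \<in> input_dists" using W by (simp add: input_dists_def stochastic_channel_def)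
  have Td: "T \<in> input_dists" unfolding T_def by (rule out_dist_input_dists[OF P W])
  have Sd: "S t \<in> input_dists" if "0 \<le> t" "t \<le> 1" for t
    using that Td Wd by (auto simp: S_def input_dists_def sum.distrib sum_distrib_left[symmetric])
  have Spos: "0 < S t y" if "0 < t" "t < 1" "0 < T y \<or> 0 < W x y" for t y
    using that Wnn[of x y] input_dists_le_1(1)[OF Td, of y]
    by (auto simp: S_def intro: add_pos_nonneg add_nonneg_pos)
  \<comment> \<open>\<open>S t\<close> is the output law of the perturbed input. Its entropy splits
    into cross entropies of \<open>T\<close> and of \<open>W x\<close> against \<open>S t\<close>.
    By Gibbs the former is at least the entropy of \<open>T\<close>, so the terms without a factor
    \<open>t\<close> cancel.\<close>
  have key: "(\<Sum>y\<in>UNIV. W x y * (- ln (S t y))) - L x \<le> F" if t: "0 < t" "t < 1" for t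
  proof -
    define Q where "Q z = (1 - t) * P z + t * (if z = x then 1 else 0)" for z
    have Q: "Q \<in> input_dists"
      using P t by (auto simp: Q_def input_dists_def sum.distrib sum_distrib_left[symmetric])
    have oQ: "out_dist Q W = S t"
      by (auto simp: out_dist_def Q_def S_def T_def fun_eq_iff sum.distrib sum_subtractf sum_distrib_left algebra_simps
          if_distrib[of "\<lambda>z. z * _"] if_distrib[of "\<lambda>z. _ * z"] cong: if_cong)
    have LQ: "(\<Sum>z\<in>UNIV. Q z * L z) = (1 - t) * (\<Sum>z\<in>UNIV. P z * L z) + t * L x"
      by (simp add: Q_def sum.distrib sum_distrib_left algebra_simps sum_subtractf
          if_distrib[of "\<lambda>z. z * _"] if_distrib[of "\<lambda>z. _ * z"] cong: if_cong)
    have "entropy_fin (S t) = (1 - t) * (\<Sum>y\<in>UNIV. T y * (- ln (S t y))) + t * (\<Sum>y\<in>UNIV. W x y * (- ln (S t y)))"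
      unfolding entropy_fin_eq sum_distrib_left sum.distrib[symmetric]
      by (intro sum.cong refl) (simp add: S_def algebra_simps)
    moreover have "(1 - t) * entropy_fin T \<le> (1 - t) * (\<Sum>y\<in>UNIV. T y * (- ln (S t y)))"
      using t Spos[of t] by (intro mult_left_mono gibbs Td Sd) auto
    moreover have "entropy_fin (S t) - ((1 - t) * (\<Sum>z\<in>UNIV. P z * L z) + t * L x) \<le> F"
      using max[OF Q] by (simp add: penalized_entropy_def oQ LQ F_def)
    moreover have "entropy_fin T = F + (\<Sum>z\<in>UNIV. P z * L z)"
      by (simp add: F_def T_def penalized_entropy_def)
    ultimately have "t * ((\<Sum>y\<in>UNIV. W x y * (- ln (S t y))) - L x) \<le> t * F"
      by (simp add: algebra_simps)
    then show ?thesis using t by (simp add: mult_le_cancel_left)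
  qed
  have pos: "0 < T y" if "0 < W x y" for y
  proof (rule ccontr)
    assume "\<not> 0 < T y"
    then have T0: "T y = 0" using input_dists_le_1(1)[OF Td, of y] by simp
    \<comment> \<open>If \<open>T y\<close> vanished, then at \<open>t = exp (- s)\<close> the term
      of \<open>y\<close> alone would be at least \<open>W x y * s\<close>. This \<open>s\<close>
      makes that exceed \<open>F + L x\<close>, against \<open>key\<close>.\<close>
    define s where "s = (\<bar>F + L x\<bar> + 1) / W x y"
    have s: "0 < s" "W x y * s = \<bar>F + L x\<bar> + 1" using that by (auto simp: s_def)
    have t: "0 < exp (-s)" "exp (-s) < 1" using s by auto
    have nn: "0 \<le> W x z * (- ln (S (exp (-s)) z))" for z
      using input_dists_le_1[OF Sd[of "exp (-s)"], of z] t s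
      by (intro mult_nonneg_nonneg Wnn) (cases "S (exp (-s)) z = 0"; simp add: ln_le_zero_iff)
    have "W x y * s \<le> W x y * (- ln (S (exp (-s)) y))"
    proof (intro mult_left_mono Wnn)
      have "ln (W x y) \<le> 0" using that input_dists_le_1[OF Wd, of y] by (simp add: ln_le_zero_iff)
      then show "s \<le> - ln (S (exp (-s)) y)" using that by (simp add: S_def T0 ln_mult)
    qed
    also have "\<dots> \<le> (\<Sum>y\<in>UNIV. W x y * (- ln (S (exp (-s)) y)))"
      using nn by (intro member_le_sum) auto
    also have "\<dots> \<le> F + L x" using key[OF t] by simp
    finally show False using s by simp
  qed
  show "0 < W x y \<Longrightarrow> 0 < out_dist P W y" using pos by (simp add: T_def)
  \<comment> \<open>Letters with \<open>W x y = 0\<close> contribute the constant 0; at the others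
    \<open>T y\<close> is positive, so \<open>ln\<close> is continuous there.\<close>
  have "((\<lambda>t. W x y * (- ln (S t y))) \<longlongrightarrow> W x y * (- ln (T y))) (at_right 0)" for y
  proof (cases "W x y = 0")
    case False
    then have "0 < T y" using pos Wnn[of x y] by (simp add: less_le)
    moreover have "((\<lambda>t. S t y) \<longlongrightarrow> (1 - 0) * T y + 0 * W x y) (at_right 0)"
      unfolding S_def by (intro tendsto_intros)
    ultimately show ?thesis by (intro tendsto_intros) auto
  qed simp
  then have "((\<lambda>t. (\<Sum>y\<in>UNIV. W x y * (- ln (S t y))) - L x)
      \<longlongrightarrow> (\<Sum>y\<in>UNIV. W x y * (- ln (T y))) - L x) (at_right 0)"
    by (intro tendsto_diff tendsto_sum tendsto_const)
  moreover have "\<forall>\<^sub>F t in at_right 0. (\<Sum>y\<in>UNIV. W x y * (- ln (S t y))) - L x \<le> F"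
    using key by (intro eventually_at_rightI[of 0 1]) auto
  ultimately show "(\<Sum>y\<in>UNIV. W x y * (- ln (out_dist P W y))) - L x \<le> penalized_entropy W L P"
    unfolding T_def F_def by (intro tendsto_upperbound) auto
qed

text \<open>The last two claims include letters that \<open>P\<close> does not use. This makes
  \<open>out_dist P W\<close> a reference law for arbitrary codewords.\<close>

lemma shannon_capacity_attained:
  fixes W :: "'a::finite \<Rightarrow> 'b::finite \<Rightarrow> real"
  assumes W: "stochastic_channel W"
  obtains P where "P \<in> input_dists" "mutual_info P W = shannon_capacity W"
    "\<And>x y. 0 < W x y \<Longrightarrow> 0 < out_dist P W y"
    "\<And>x. (\<Sum>y\<in>UNIV. W x y * (- ln (out_dist P W y))) - entropy_fin (W x) \<le> shannon_capacity W"
proof -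
  define L where "L = (\<lambda>x. entropy_fin (W x))"
  obtain P where P: "P \<in> input_dists"
    and max: "\<And>Q. Q \<in> input_dists \<Longrightarrow> penalized_entropy W L Q \<le> penalized_entropy W L P"
    using penalized_entropy_attains_max[OF W] by blast
  have "shannon_capacity W = penalized_entropy W L P"
    unfolding shannon_capacity_def using P max
    by (intro cSup_eq_maximum) (auto simp: mutual_info_eq[OF _ W] L_def)
  then show ?thesis
    using penalized_entropy_kkt[OF W P max] P
    by (intro that[of P]) (auto simp: mutual_info_eq[OF _ W] L_def)
qed

lemma H_max_attained:
  fixes W :: "'a::finite \<Rightarrow> 'b::finite \<Rightarrow> real"
  assumes W: "stochastic_channel W"
  obtains P where "P \<in> input_dists" "entropy_fin (out_dist P W) = H_max W"
    "\<And>x y. 0 < W x y \<Longrightarrow> 0 < out_dist P W y"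
    "\<And>x. (\<Sum>y\<in>UNIV. W x y * (- ln (out_dist P W y))) \<le> H_max W"
proof -
  obtain P where P: "P \<in> input_dists"
    and max: "\<And>Q. Q \<in> input_dists \<Longrightarrow> penalized_entropy W (\<lambda>_. 0) Q \<le> penalized_entropy W (\<lambda>_. 0) P"
    using penalized_entropy_attains_max[OF W] by blast
  have "H_max W = penalized_entropy W (\<lambda>_. 0) P"
    unfolding H_max_def using P max
    by (intro cSup_eq_maximum) (auto simp: penalized_entropy_def)
  then show ?thesis
    using penalized_entropy_kkt[OF W P max] P
    by (intro that[of P]) (auto simp: penalized_entropy_def)
qed

text \<open>The row of a single letter has cross entropy against the optimal output law at least its
  own entropy. Nonnegativity matches the value 0 that the capacity takes when no positive rate is
  achievable.\<close>

lemma shannon_capacity_nonneg: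
  assumes W: "stochastic_channel W"
  shows "0 \<le> shannon_capacity W"
proof -
  obtain P where P: "P \<in> input_dists" and pos: "\<And>x y. 0 < W x y \<Longrightarrow> 0 < out_dist P W y"
    and le: "\<And>x. (\<Sum>y\<in>UNIV. W x y * (- ln (out_dist P W y))) - entropy_fin (W x) \<le> shannon_capacity W"
    using shannon_capacity_attained[OF W] by metis
  have "W undefined \<in> input_dists" using W by (simp add: stochastic_channel_def input_dists_def)
  from gibbs[OF this out_dist_input_dists[OF P W] pos[of undefined]] le[of undefined] show ?thesis by simp
qed

subsection \<open>Cloud marginals and the ML decoder\<close>

lemma num_of_le: "real (num_of r n) \<le> exp (real n * r)"
  by (simp add: num_of_def)

lemma num_of_pos: "0 \<le> r \<Longrightarrow> 0 < num_of r n"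
  by (simp add: num_of_def)

lemma num_of_ge:
  assumes "0 \<le> r" shows "exp (real n * r) \<le> 2 * real (num_of r n)"
proof -
  have "1 \<le> exp (real n * r)" using assms by simp
  then have "1 \<le> \<lfloor>exp (real n * r)\<rfloor>" by simp
  then show ?thesis
    using floor_less_iff[of "exp (real n * r)" "\<lfloor>exp (real n * r)\<rfloor> + 1"] unfolding num_of_def by linarith
qed

lemma inst_prob_eq: "inst_prob W n M N c Y = (\<Prod>mj\<in>{..<M} \<times> {..<N}. seq_prob W n (c (fst mj)) (Y mj))"
  by (simp add: inst_prob_def seq_prob_def)

lemma finite_instances [simp]: "finite (instances n M N :: (nat \<times> nat \<Rightarrow> nat \<Rightarrow> 'b::finite) set)"
  by (simp add: instances_def finite_PiE)

lemma instances_mem: "Y \<in> instances n M N \<Longrightarrow> m < M \<Longrightarrow> j < N \<Longrightarrow> Y (m, j) \<in> seqs n"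
  by (auto simp: instances_def)

lemma inst_prob_nonneg: "stochastic_channel W \<Longrightarrow> 0 \<le> inst_prob W n M N c Y"
  by (simp add: inst_prob_eq prod_nonneg seq_prob_nonneg)

lemma sum_inst_prob:
  assumes "stochastic_channel W" shows "(\<Sum>Y\<in>instances n M N. inst_prob W n M N c Y) = 1"
  unfolding inst_prob_eq instances_def using assms
  by (subst prod_sum_PiE[symmetric, where f = "\<lambda>mj. seq_prob W n (c (fst mj))"]) (auto simp: sum_seq_prob)

lemma inst_marginal:
  assumes "stochastic_channel W" "m < M" "j < N"
  shows "(\<Sum>Y\<in>instances n M N. inst_prob W n M N c Y * g (Y (m, j))) = (\<Sum>y\<in>seqs n. seq_prob W n (c m) y * g y)"
  unfolding inst_prob_eq instances_def using assms
  by (subst sum_PiE_marginal[where p = "\<lambda>mj. seq_prob W n (c (fst mj))" and k = "(m, j)"])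
    (auto simp: sum_seq_prob)

lemma inst_marginal2:
  assumes "stochastic_channel W" "m < M" "j < N" "m' < M" "j' < N" "m \<noteq> m'"
  shows "(\<Sum>Y\<in>instances n M N. inst_prob W n M N c Y * G (Y (m, j)) (Y (m', j')))
    = (\<Sum>y\<in>seqs n. \<Sum>z\<in>seqs n. seq_prob W n (c m) y * seq_prob W n (c m') z * G y z)"
  unfolding inst_prob_eq instances_def using assms
  by (subst sum_PiE_marginal2[where p = "\<lambda>mj. seq_prob W n (c (fst mj))" and k = "(m, j)" and l = "(m', j')"])
    (auto simp: sum_seq_prob)

section \<open>Random codebooks with i.i.d. letters\<close>

definition codebooks :: "nat \<Rightarrow> nat \<Rightarrow> (nat \<Rightarrow> nat \<Rightarrow> 'a) set" where
  "codebooks n M = PiE {..<M} (\<lambda>_. seqs n)"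

definition codebook_prob :: "('a \<Rightarrow> real) \<Rightarrow> nat \<Rightarrow> nat \<Rightarrow> (nat \<Rightarrow> nat \<Rightarrow> 'a) \<Rightarrow> real" where
  "codebook_prob P n M c = (\<Prod>m<M. iid_prob P n (c m))"

lemma finite_codebooks [simp]: "finite (codebooks n M :: (nat \<Rightarrow> nat \<Rightarrow> 'a::finite) set)"
  by (simp add: codebooks_def finite_PiE)

lemma codebook_prob_nonneg: "P \<in> input_dists \<Longrightarrow> 0 \<le> codebook_prob P n M c"
  by (simp add: codebook_prob_def prod_nonneg iid_prob_nonneg)

lemma sum_codebook_prob:
  "P \<in> input_dists \<Longrightarrow> (\<Sum>c\<in>codebooks n M. codebook_prob P n M c) = 1"
  unfolding codebook_prob_def codebooks_def
  by (subst prod_sum_PiE[symmetric, where f = "\<lambda>m. iid_prob P n"]) (auto simp: sum_iid_prob)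

lemma codebook_marginal:
  assumes "P \<in> input_dists" "m < M"
  shows "(\<Sum>c\<in>codebooks n M. codebook_prob P n M c * g (c m)) = (\<Sum>x\<in>seqs n. iid_prob P n x * g x)"
  unfolding codebook_prob_def codebooks_def using assms
  by (subst sum_PiE_marginal[where p = "\<lambda>m. iid_prob P n" and k = m]) (auto simp: sum_iid_prob)

lemma codebook_marginal2:
  assumes "P \<in> input_dists" "m < M" "m' < M" "m \<noteq> m'"
  shows "(\<Sum>c\<in>codebooks n M. codebook_prob P n M c * G (c m) (c m'))
    = (\<Sum>x\<in>seqs n. \<Sum>z\<in>seqs n. iid_prob P n x * iid_prob P n z * G x z)"
  unfolding codebook_prob_def codebooks_def using assms
  by (subst sum_PiE_marginal2[where p = "\<lambda>m. iid_prob P n" and k = m and l = m']) (auto simp: sum_iid_prob)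

section \<open>Copies in a cloud and the ML rule\<close>

lemma sum_cloud_eq_sum_copies:
  fixes Y :: "nat \<times> nat \<Rightarrow> nat \<Rightarrow> 'b::finite"
  assumes "Y \<in> instances n M N" "m < M"
  shows "(\<Sum>j<N. f (Y (m, j))) = (\<Sum>y\<in>seqs n. real (copies N Y m y) * f y)"
proof -
  have "(\<Sum>j<N. f (Y (m, j))) = (\<Sum>y\<in>seqs n. \<Sum>j\<in>{j\<in>{..<N}. Y (m, j) = y}. f (Y (m, j)))"
    using assms instances_mem[OF assms] by (intro sum.group[symmetric]) auto
  also have "\<dots> = (\<Sum>y\<in>seqs n. real (copies N Y m y) * f y)"
    by (intro sum.cong refl) (simp add: copies_def)
  finally show ?thesis .
qed

lemma ml_correct_nonneg: "0 \<le> ml_correct M N Y m y"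
  by (simp add: ml_correct_def Let_def)

text \<open>Given \<open>y\<close>, the output is uniform on the messages with the largest count, so
  weights that depend only on the count collapse to their value at the maximum. A constant weight 1
  gives total probability 1, and \<open>f = real\<close> gives the largest count.\<close>

lemma sum_ml_correct_weighted:
  assumes "0 < M"
  shows "(\<Sum>m<M. f (copies N Y m y) * ml_correct M N Y m y) = f (Max ((\<lambda>m'. copies N Y m' y) ` {..<M}))"
proof -
  define mx where "mx = Max ((\<lambda>m'. copies N Y m' y) ` {..<M})"
  define V where "V = {m. m < M \<and> copies N Y m y = mx}"
  have "mx \<in> (\<lambda>m'. copies N Y m' y) ` {..<M}" unfolding mx_def using assms by (intro Max_in) auto
  then have "V \<noteq> {}" by (auto simp: V_def)
  moreover have "finite V" by (simp add: V_def)
  ultimately have V: "card V > 0" by (simp add: card_gt_0_iff)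
  have "(\<Sum>m<M. f (copies N Y m y) * ml_correct M N Y m y) = (\<Sum>m\<in>V. f mx * (1 / real (card V)))"
    by (intro sum.mono_neutral_cong_right) (auto simp: V_def ml_correct_def Let_def mx_def)
  then show ?thesis using V by (simp add: mx_def)
qed

lemma sum_ml_correct_le: "(\<Sum>m<M. ml_correct M N Y m y) \<le> 1"
  using sum_ml_correct_weighted[of M "\<lambda>_. 1" N Y y] by (cases "M = 0") auto

lemma ml_correct_le: "m < M \<Longrightarrow> ml_correct M N Y m y \<le> 1"
  by (rule order_trans[OF _ sum_ml_correct_le[of M N Y y]], rule member_le_sum) (auto simp: ml_correct_nonneg)

text \<open>\<phi> is any randomized decision upon receiving \<open>y\<close>, possibly with
  erasure. It averages the counts with total weight at most 1, hence stays below the largest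
  count.\<close>

lemma ml_decoder_optimal:
  assumes "\<And>m. m < M \<Longrightarrow> 0 \<le> \<phi> m" "(\<Sum>m<M. \<phi> m) \<le> 1"
  shows "(\<Sum>m<M. real (copies N Y m y) * \<phi> m) \<le> (\<Sum>m<M. real (copies N Y m y) * ml_correct M N Y m y)"
proof (cases "M = 0")
  case False
  define mx where "mx = Max ((\<lambda>m'. copies N Y m' y) ` {..<M})"
  have "(\<Sum>m<M. real (copies N Y m y) * \<phi> m) \<le> (\<Sum>m<M. real mx * \<phi> m)"
    using assms by (intro sum_mono mult_right_mono) (auto simp: mx_def)
  also have "\<dots> \<le> real mx"
    using mult_left_mono[OF assms(2), of "real mx"] by (simp add: sum_distrib_left)
  finally show ?thesis
    using sum_ml_correct_weighted[of M real N Y y] False by (simp add: mx_def)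
qed simp

text \<open>The comparison decoder decides for \<open>m\<close> when \<open>m\<close> alone passes
  the test and erases otherwise. A union bound over failure of the true message and success of a
  wrong one bounds its performance, separately for each instance.\<close>

lemma ml_correct_ge_unique_test:
  fixes Y :: "nat \<times> nat \<Rightarrow> nat \<Rightarrow> 'b::finite"
  assumes Y: "Y \<in> instances n M N"
  shows "(\<Sum>m<M. \<Sum>j<N. 1 - (of_bool (\<not> a m (Y (m, j))) + (\<Sum>m'\<in>{..<M} - {m}. of_bool (a m' (Y (m, j))))))
    \<le> (\<Sum>m<M. \<Sum>j<N. ml_correct M N Y m (Y (m, j)))"
proof -
  define \<phi> where "\<phi> m y = (of_bool (a m y \<and> (\<forall>m'<M. m' \<noteq> m \<longrightarrow> \<not> a m' y)) :: real)" for m y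
  have "(\<Sum>m<M. \<phi> m y) \<le> 1" for y
  proof (cases "\<exists>m<M. \<phi> m y \<noteq> 0")
    case True
    then obtain m0 where m0: "m0 < M" "\<phi> m0 y \<noteq> 0" by blast
    then have "\<phi> m y = 0" if "m < M" "m \<noteq> m0" for m
      using that by (auto simp: \<phi>_def split: if_splits)
    then have "(\<Sum>m<M. \<phi> m y) = (\<Sum>m\<in>{m0}. \<phi> m y)"
      using m0 by (intro sum.mono_neutral_right) auto
    also have "\<dots> \<le> 1" by (simp add: \<phi>_def del: sum_of_bool_eq)
    finally show ?thesis .
  qed simp
  then have opt: "(\<Sum>m<M. real (copies N Y m y) * \<phi> m y)
      \<le> (\<Sum>m<M. real (copies N Y m y) * ml_correct M N Y m y)" for y
    by (intro ml_decoder_optimal) (simp_all add: \<phi>_def)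
  have "1 - (of_bool (\<not> a m y) + (\<Sum>m'\<in>{..<M} - {m}. of_bool (a m' y))) \<le> \<phi> m y" for m y
  proof (cases "\<phi> m y = 1")
    case False
    then consider "\<not> a m y" | m' where "m' \<in> {..<M} - {m}" "a m' y"
      by (auto simp: \<phi>_def split: if_splits)
    then show ?thesis
    proof cases
      case 2
      then have "of_bool (a m' y) \<le> (\<Sum>m'\<in>{..<M} - {m}. of_bool (a m' y) :: real)"
        by (intro member_le_sum) auto
      then show ?thesis using 2 by (simp add: \<phi>_def)
    qed (simp add: \<phi>_def sum_nonneg)
  qed (simp add: sum_nonneg)
  then have "(\<Sum>m<M. \<Sum>j<N. 1 - (of_bool (\<not> a m (Y (m, j))) + (\<Sum>m'\<in>{..<M} - {m}. of_bool (a m' (Y (m, j))))))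
      \<le> (\<Sum>m<M. \<Sum>j<N. \<phi> m (Y (m, j)))"
    by (intro sum_mono)
  also have "\<dots> = (\<Sum>y\<in>seqs n. \<Sum>m<M. real (copies N Y m y) * \<phi> m y)"
    by (subst sum.swap) (simp add: sum_cloud_eq_sum_copies[OF Y])
  also have "\<dots> \<le> (\<Sum>y\<in>seqs n. \<Sum>m<M. real (copies N Y m y) * ml_correct M N Y m y)"
    by (intro sum_mono opt)
  also have "\<dots> = (\<Sum>m<M. \<Sum>j<N. ml_correct M N Y m (Y (m, j)))"
    by (subst sum.swap) (simp add: sum_cloud_eq_sum_copies[OF Y, symmetric])
  finally show ?thesis .
qed

lemma ml_error_nonneg:
  assumes W: "stochastic_channel W"
  shows "0 \<le> ml_error W n M N c"
proof -
  have "(\<Sum>m<M. \<Sum>j<N. ml_correct M N Y m (Y (m, j)) / (real M * real N)) \<le> 1" for Y :: "nat \<times> nat \<Rightarrow> nat \<Rightarrow> 'b"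
  proof -
    have "(\<Sum>m<M. \<Sum>j<N. ml_correct M N Y m (Y (m, j))) \<le> (\<Sum>m<M. \<Sum>j<N. 1)"
      by (intro sum_mono ml_correct_le) auto
    then show ?thesis
      unfolding sum_divide_distrib[symmetric] by (cases "M = 0 \<or> N = 0") auto
  qed
  then have "(\<Sum>Y\<in>instances n M N. inst_prob W n M N c Y *
        (\<Sum>m<M. \<Sum>j<N. ml_correct M N Y m (Y (m, j)) / (real M * real N)))
      \<le> (\<Sum>Y\<in>instances n M N. inst_prob W n M N c Y * 1)"
    by (intro sum_mono mult_left_mono inst_prob_nonneg W)
  then show ?thesis by (simp add: ml_error_def sum_inst_prob[OF W])
qed

text \<open>The test may depend on the instance \<open>Y\<close>, since the decoder knows the
  clouds; testing for membership in a cloud relies on this.\<close>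

lemma ml_error_le_unique_test:
  fixes W :: "'a::finite \<Rightarrow> 'b::finite \<Rightarrow> real"
  assumes W: "stochastic_channel W" and "0 < M" "0 < N"
  shows "ml_error W n M N c \<le> (\<Sum>m<M. \<Sum>j<N. (\<Sum>Y\<in>instances n M N. inst_prob W n M N c Y * of_bool (\<not> a Y m (Y (m, j))))
      + (\<Sum>m'\<in>{..<M} - {m}. \<Sum>Y\<in>instances n M N. inst_prob W n M N c Y * of_bool (a Y m' (Y (m, j))))) / (real M * real N)"
proof -
  define b where "b Y m j = (of_bool (\<not> a Y m (Y (m, j))) + (\<Sum>m'\<in>{..<M} - {m}. of_bool (a Y m' (Y (m, j)))) :: real)"
    for Y :: "nat \<times> nat \<Rightarrow> nat \<Rightarrow> 'b" and m j
  have "1 - (\<Sum>m<M. \<Sum>j<N. b Y m j) / (real M * real N)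
      \<le> (\<Sum>m<M. \<Sum>j<N. ml_correct M N Y m (Y (m, j)) / (real M * real N))" if "Y \<in> instances n M N" for Y
  proof -
    have "real M * real N - (\<Sum>m<M. \<Sum>j<N. b Y m j) \<le> (\<Sum>m<M. \<Sum>j<N. ml_correct M N Y m (Y (m, j)))"
      using ml_correct_ge_unique_test[OF that, of "a Y"] unfolding b_def[symmetric] by (simp add: sum_subtractf)
    from divide_right_mono[OF this, of "real M * real N"] show ?thesis
      using assms by (simp add: sum_divide_distrib[symmetric] diff_divide_distrib)
  qed
  then have "(\<Sum>Y\<in>instances n M N. inst_prob W n M N c Y * (1 - (\<Sum>m<M. \<Sum>j<N. b Y m j) / (real M * real N)))
      \<le> (\<Sum>Y\<in>instances n M N. inst_prob W n M N c Y *
        (\<Sum>m<M. \<Sum>j<N. ml_correct M N Y m (Y (m, j)) / (real M * real N)))"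
    by (intro sum_mono mult_left_mono inst_prob_nonneg W)
  then have "ml_error W n M N c \<le> (\<Sum>Y\<in>instances n M N. inst_prob W n M N c Y * (\<Sum>m<M. \<Sum>j<N. b Y m j)) / (real M * real N)"
    unfolding ml_error_def right_diff_distrib sum_subtractf mult_1_right sum_inst_prob[OF W]
      times_divide_eq_right[of "inst_prob _ _ _ _ _ _" "\<Sum>m<M. \<Sum>j<N. b _ m j"] sum_divide_distrib[symmetric]
    by simp
  also have "(\<Sum>Y\<in>instances n M N. inst_prob W n M N c Y * (\<Sum>m<M. \<Sum>j<N. b Y m j))
      = (\<Sum>m<M. \<Sum>j<N. \<Sum>Y\<in>instances n M N. inst_prob W n M N c Y * b Y m j)"
    unfolding sum_distrib_left
    by (subst sum.swap, rule sum.cong[OF refl], subst sum.swap) (rule refl)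
  also have "\<dots> = (\<Sum>m<M. \<Sum>j<N. (\<Sum>Y\<in>instances n M N. inst_prob W n M N c Y * of_bool (\<not> a Y m (Y (m, j))))
      + (\<Sum>m'\<in>{..<M} - {m}. \<Sum>Y\<in>instances n M N. inst_prob W n M N c Y * of_bool (a Y m' (Y (m, j)))))"
    unfolding b_def distrib_left sum.distrib sum_distrib_left
    by (intro arg_cong2[where f = "(+)"] sum.cong refl sum.swap)
  finally show ?thesis .
qed

text \<open>If every codebook were worse than the bound, so would be the average; strictness comes
  from a codebook of positive probability. The factor \<open>M\<close> counts competing messages,
  with \<open>M - 1\<close> rounded up.\<close>

lemma random_coding:
  fixes W :: "'a::finite \<Rightarrow> 'b::finite \<Rightarrow> real"
  assumes W: "stochastic_channel W" and P: "P \<in> input_dists" and "0 < M" "0 < N" "0 \<le> \<beta>"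
    and miss: "\<And>m j. m < M \<Longrightarrow> j < N \<Longrightarrow> (\<Sum>c\<in>codebooks n M. codebook_prob P n M c *
        (\<Sum>Y\<in>instances n M N. inst_prob W n M N c Y * of_bool (\<not> a c Y m (Y (m, j))))) \<le> \<alpha>"
    and clash: "\<And>m m' j. m < M \<Longrightarrow> m' < M \<Longrightarrow> m \<noteq> m' \<Longrightarrow> j < N \<Longrightarrow> (\<Sum>c\<in>codebooks n M. codebook_prob P n M c *
        (\<Sum>Y\<in>instances n M N. inst_prob W n M N c Y * of_bool (a c Y m' (Y (m, j))))) \<le> \<beta>"
  shows "\<exists>c. ml_error W n M N c \<le> \<alpha> + real M * \<beta>"
proof (rule ccontr)
  assume "\<not> ?thesis"
  then have gt: "\<alpha> + real M * \<beta> < ml_error W n M N c" for c by (simp add: not_le)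
  define A where "A c m j = (\<Sum>Y\<in>instances n M N. inst_prob W n M N c Y * of_bool (\<not> a c Y m (Y (m, j))))" for c m j
  define B where "B c m m' j = (\<Sum>Y\<in>instances n M N. inst_prob W n M N c Y * of_bool (a c Y m' (Y (m, j))))" for c m m' j
  let ?p = "codebook_prob P n M" and ?C = "codebooks n M"
  let ?E = "\<lambda>f. \<Sum>c\<in>?C. ?p c * f c"
  have "?E (\<lambda>c. \<Sum>m<M. \<Sum>j<N. A c m j + (\<Sum>m'\<in>{..<M} - {m}. B c m m' j))
      = (\<Sum>m<M. \<Sum>j<N. ?E (\<lambda>c. A c m j) + (\<Sum>m'\<in>{..<M} - {m}. ?E (\<lambda>c. B c m m' j)))"
    unfolding sum_distrib_left sum.swap[of _ _ ?C] distrib_left sum.distrib by (rule refl)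
  also have "\<dots> \<le> (\<Sum>m<M. \<Sum>j<N. \<alpha> + (\<Sum>m'\<in>{..<M} - {m}. \<beta>))"
    using miss clash unfolding A_def B_def by (intro sum_mono add_mono) auto
  also have "\<dots> \<le> (\<Sum>m<M. \<Sum>j<N. \<alpha> + real M * \<beta>)"
    using \<open>0 \<le> \<beta>\<close> by (intro sum_mono add_mono order_refl) (auto intro!: mult_right_mono)
  also have "\<dots> = real M * real N * (\<alpha> + real M * \<beta>)" by simp
  finally have "?E (\<lambda>c. \<Sum>m<M. \<Sum>j<N. A c m j + (\<Sum>m'\<in>{..<M} - {m}. B c m m' j)) / (real M * real N) \<le> \<alpha> + real M * \<beta>"
    using assms by (simp add: divide_le_eq mult.commute)
  moreover have "?E (\<lambda>c. ml_error W n M N c)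
      \<le> ?E (\<lambda>c. (\<Sum>m<M. \<Sum>j<N. A c m j + (\<Sum>m'\<in>{..<M} - {m}. B c m m' j)) / (real M * real N))"
    unfolding A_def B_def using assms
    by (intro sum_mono mult_left_mono codebook_prob_nonneg ml_error_le_unique_test) auto
  ultimately have le: "?E (\<lambda>c. ml_error W n M N c) \<le> \<alpha> + real M * \<beta>"
    unfolding times_divide_eq_right sum_divide_distrib[symmetric] by linarith
  have "\<alpha> + real M * \<beta> = ?E (\<lambda>_. \<alpha> + real M * \<beta>)"
    by (simp add: sum_distrib_right[symmetric] sum_codebook_prob[OF P])
  also have "\<dots> < ?E (\<lambda>c. ml_error W n M N c)"
  proof (rule sum_strict_mono_ex1)
    show "\<exists>c\<in>?C. ?p c * (\<alpha> + real M * \<beta>) < ?p c * ml_error W n M N c"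
    proof -
      have "\<exists>c\<in>?C. ?p c \<noteq> 0" using sum_codebook_prob[OF P, of n M] by (metis sum.neutral zero_neq_one)
      then obtain c where "c \<in> ?C" "0 < ?p c" using codebook_prob_nonneg[OF P] by (metis less_le)
      then show ?thesis using gt by (intro bexI[of _ c] mult_strict_left_mono)
    qed
  qed (use gt[THEN less_imp_le] codebook_prob_nonneg[OF P] in \<open>auto intro!: mult_left_mono\<close>)
  finally show False using le by simp
qed

lemma achievableI:
  fixes W :: "'a::finite \<Rightarrow> 'b::finite \<Rightarrow> real"
  assumes W: "stochastic_channel W" and "\<epsilon> \<longlonglongrightarrow> 0"
    and "\<And>n. \<exists>c. ml_error W n (num_of R n) (num_of K n) c \<le> \<epsilon> n"
  shows "achievable W K R"
proof -
  obtain c where "\<And>n. ml_error W n (num_of R n) (num_of K n) (c n) \<le> \<epsilon> n"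
    using assms(3) by metis
  then have "(\<lambda>n. ml_error W n (num_of R n) (num_of K n) (c n)) \<longlonglongrightarrow> 0"
    by (intro tendsto_sandwich[OF _ _ tendsto_const \<open>\<epsilon> \<longlonglongrightarrow> 0\<close>] always_eventually allI ml_error_nonneg[OF W])
  then show ?thesis unfolding achievable_def by blast
qed

subsection \<open>Achievability\<close>

lemma tail_plus_exp_tendsto_0:
  assumes "0 \<le> \<rho>" "\<rho> < 1" "0 < d"
  shows "(\<lambda>n. \<rho> ^ n + exp (- (real n * d))) \<longlonglongrightarrow> 0"
proof -
  have "(\<lambda>n. \<rho> ^ n + exp (- d) ^ n) \<longlonglongrightarrow> 0 + 0"
    using assms by (intro tendsto_add LIMSEQ_realpow_zero) auto
  moreover have "exp (- d) ^ n = exp (- (real n * d))" for n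
    using exp_of_nat_mult[of n "- d"] by simp
  ultimately show ?thesis by simp
qed

text \<open>A single cloud element is an output of the memoryless channel, so a test that looks only
  at codeword and received vector gives Shannon's bound for any cloud size.\<close>

lemma achievable_below_mutual_info:
  fixes W :: "'a::finite \<Rightarrow> 'b::finite \<Rightarrow> real"
  assumes W: "stochastic_channel W" and P: "P \<in> input_dists"
    and "0 \<le> K" "0 \<le> R" and R: "R < mutual_info P W"
  shows "achievable W K R"
proof -
  define T where "T = out_dist P W"
  define r where "r = (R + mutual_info P W) / 2"
  have r: "R < r" "r < mutual_info P W" using R by (auto simp: r_def)
  have Td: "T \<in> input_dists" unfolding T_def by (rule out_dist_input_dists[OF P W])
  have nn: "0 \<le> P x" "0 \<le> W x y" for x y
    using P W by (auto simp: input_dists_def stochastic_channel_def)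
  \<comment> \<open>A failed likelihood-ratio test forces a nonnegative sum of \<open>g\<close>,
    while the mean of \<open>g\<close> is \<open>r - mutual_info P W\<close>, which is
    negative.\<close>
  define g where "g x y = r - ln (W x y / T y)" for x y
  have "(\<Sum>x\<in>UNIV. \<Sum>y\<in>UNIV. P x * W x y * g x y)
      = r * (\<Sum>x\<in>UNIV. P x * (\<Sum>y\<in>UNIV. W x y)) - mutual_info P W"
    unfolding mutual_info_def T_def[symmetric] sum_distrib_left sum_subtractf[symmetric]
    by (intro sum.cong refl) (auto simp: g_def algebra_simps)
  also have "\<dots> < 0" using W P r by (simp add: stochastic_channel_def input_dists_def)
  finally obtain \<rho> where \<rho>: "0 \<le> \<rho>" "\<rho> < 1"
    and tail: "\<And>n. (\<Sum>x\<in>seqs n. \<Sum>y\<in>seqs n. iid_prob P n x * seq_prob W n x y *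
        of_bool (0 \<le> (\<Sum>i<n. g (x i) (y i)))) \<le> \<rho> ^ n"
    using joint_tail[OF W P, of g] by blast
  show ?thesis
  proof (rule achievableI[OF W tail_plus_exp_tendsto_0[OF \<rho>, of "r - R"]])
    fix n
    define t where "t x y \<longleftrightarrow> exp (real n * r) * iid_prob T n y \<le> seq_prob W n x y" for x y
    let ?M = "num_of R n" and ?N = "num_of K n"
    have atypical: "(\<Sum>x\<in>seqs n. \<Sum>y\<in>seqs n. iid_prob P n x * seq_prob W n x y * of_bool (\<not> t x y)) \<le> \<rho> ^ n"
    proof (rule order_trans[OF sum_mono[OF sum_mono] tail])
      fix x y
      show "iid_prob P n x * seq_prob W n x y * of_bool (\<not> t x y)
        \<le> iid_prob P n x * seq_prob W n x y * of_bool (0 \<le> (\<Sum>i<n. g (x i) (y i)))"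
      proof (cases "iid_prob P n x * seq_prob W n x y = 0 \<or> t x y")
        case False
        then have "P (x i) * W (x i) (y i) \<noteq> 0" if "i < n" for i
          using that by (auto simp: iid_prob_def seq_prob_def)
        then have PW: "0 < P (x i) * W (x i) (y i)" if "i < n" for i
          using that nn by (metis less_le mult_nonneg_nonneg)
        have Wp: "0 < W (x i) (y i)" if "i < n" for i
          using PW[OF that] nn by (auto simp: zero_less_mult_iff less_le)
        have Tp: "0 < T (y i)" if "i < n" for i
          unfolding T_def by (rule out_dist_pos[OF P W PW[OF that]])
        note l = ln_iid_prob[of n T y, OF Tp] ln_seq_prob[of n W x y, OF Wp]
        have "ln (seq_prob W n x y) \<le> ln (exp (real n * r) * iid_prob T n y)"
          using False l seq_prob_pos_iff[OF W, of n x y] Wp by (subst ln_le_cancel_iff) (auto simp: t_def)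
        then have "ln (seq_prob W n x y) \<le> real n * r + ln (iid_prob T n y)"
          using l(1) by (simp add: ln_mult)
        moreover have "(\<Sum>i<n. ln (W (x i) (y i) / T (y i)))
            = (\<Sum>i<n. ln (W (x i) (y i)) - ln (T (y i)))"
          using Wp Tp by (intro sum.cong refl ln_divide_pos) auto
        ultimately have "0 \<le> (\<Sum>i<n. g (x i) (y i))" by (simp add: g_def l sum_subtractf)
        then show ?thesis using iid_prob_nonneg[OF P] seq_prob_nonneg[OF W] by simp
      qed (use iid_prob_nonneg[OF P] seq_prob_nonneg[OF W] in auto)
    qed
    \<comment> \<open>Change of measure: averaging over the sent codeword gives \<open>y\<close> the
      product law of \<open>T\<close>, independently of \<open>x'\<close>. The test bounds this law
      by \<open>exp (- n r)\<close> times the law given \<open>x'\<close>, which sums to 1.\<close>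
    have impostor: "(\<Sum>x\<in>seqs n. \<Sum>x'\<in>seqs n. iid_prob P n x * iid_prob P n x' *
        (\<Sum>y\<in>seqs n. seq_prob W n x y * of_bool (t x' y))) \<le> exp (- (real n * r))"
    proof -
      have "(\<Sum>x\<in>seqs n. \<Sum>x'\<in>seqs n. iid_prob P n x * iid_prob P n x' *
          (\<Sum>y\<in>seqs n. seq_prob W n x y * of_bool (t x' y)))
        = (\<Sum>x\<in>seqs n. \<Sum>x'\<in>seqs n. \<Sum>y\<in>seqs n. iid_prob P n x * seq_prob W n x y * (iid_prob P n x' * of_bool (t x' y)))"
        by (simp add: sum_distrib_left mult_ac del: sum_mult_of_bool_eq sum_of_bool_mult_eq)
      also have "\<dots> = (\<Sum>x'\<in>seqs n. \<Sum>y\<in>seqs n. \<Sum>x\<in>seqs n. iid_prob P n x * seq_prob W n x y * (iid_prob P n x' * of_bool (t x' y)))"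
        by (subst sum.swap, rule sum.cong[OF refl], rule sum.swap)
      also have "\<dots> = (\<Sum>x'\<in>seqs n. \<Sum>y\<in>seqs n. iid_prob P n x' * (iid_prob T n y * of_bool (t x' y)))"
        unfolding sum_distrib_right[symmetric] sum_iid_seq_prob T_def[symmetric] by (simp add: mult_ac)
      also have "\<dots> \<le> (\<Sum>x'\<in>seqs n. \<Sum>y\<in>seqs n. iid_prob P n x' * (exp (- (real n * r)) * seq_prob W n x' y))"
      proof (intro sum_mono mult_left_mono iid_prob_nonneg[OF P])
        fix x' y
        have "iid_prob T n y \<le> exp (- (real n * r)) * seq_prob W n x' y" if "t x' y"
          using mult_left_mono[OF that[unfolded t_def], of "exp (- (real n * r))"]
          by (simp add: mult.assoc[symmetric] exp_add[symmetric])
        then show "iid_prob T n y * of_bool (t x' y) \<le> exp (- (real n * r)) * seq_prob W n x' y"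
          using seq_prob_nonneg[OF W] by (auto simp: of_bool_def)
      qed
      also have "\<dots> = exp (- (real n * r))"
        by (simp add: sum_distrib_left[symmetric] sum_distrib_right[symmetric] sum_seq_prob[OF W] sum_iid_prob[OF P])
      finally show ?thesis .
    qed
    have "\<exists>c. ml_error W n ?M ?N c \<le> \<rho> ^ n + real ?M * exp (- (real n * r))"
    proof (rule random_coding[OF W P num_of_pos num_of_pos, where a = "\<lambda>c Y m y. t (c m) y"])
      fix m j assume "m < ?M" "j < ?N"
      then have "(\<Sum>Y\<in>instances n ?M ?N. inst_prob W n ?M ?N c Y * of_bool (\<not> t (c m) (Y (m, j))))
          = (\<Sum>y\<in>seqs n. seq_prob W n (c m) y * of_bool (\<not> t (c m) y))" for c
        by (rule inst_marginal[OF W, where g = "\<lambda>y. of_bool (\<not> t (c m) y)"])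
      then show "(\<Sum>c\<in>codebooks n ?M. codebook_prob P n ?M c *
          (\<Sum>Y\<in>instances n ?M ?N. inst_prob W n ?M ?N c Y * of_bool (\<not> t (c m) (Y (m, j))))) \<le> \<rho> ^ n"
        using atypical codebook_marginal[OF P \<open>m < ?M\<close>,
            where g = "\<lambda>x. \<Sum>y\<in>seqs n. seq_prob W n x y * of_bool (\<not> t x y)"]
        by (simp add: sum_distrib_left mult.assoc del: sum_mult_of_bool_eq)
    next
      fix m m' j assume "m < ?M" "m' < ?M" "m \<noteq> m'" "j < ?N"
      have "(\<Sum>Y\<in>instances n ?M ?N. inst_prob W n ?M ?N c Y * of_bool (t (c m') (Y (m, j))))
          = (\<Sum>y\<in>seqs n. seq_prob W n (c m) y * of_bool (t (c m') y))" for c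
        by (rule inst_marginal[OF W \<open>m < ?M\<close> \<open>j < ?N\<close>, where g = "\<lambda>y. of_bool (t (c m') y)"])
      then show "(\<Sum>c\<in>codebooks n ?M. codebook_prob P n ?M c *
          (\<Sum>Y\<in>instances n ?M ?N. inst_prob W n ?M ?N c Y * of_bool (t (c m') (Y (m, j))))) \<le> exp (- (real n * r))"
        using impostor codebook_marginal2[OF P \<open>m < ?M\<close> \<open>m' < ?M\<close> \<open>m \<noteq> m'\<close>,
            where G = "\<lambda>x x'. \<Sum>y\<in>seqs n. seq_prob W n x y * of_bool (t x' y)"]
        by (simp del: sum_mult_of_bool_eq)
    qed (use assms in auto)
    moreover have "real ?M * exp (- (real n * r)) \<le> exp (- (real n * (r - R)))"
      using mult_right_mono[OF num_of_le[of R n], of "exp (- (real n * r))"]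
      by (simp add: exp_add[symmetric] algebra_simps)
    ultimately show "\<exists>c. ml_error W n ?M ?N c \<le> \<rho> ^ n + exp (- (real n * (r - R)))"
      by (elim exE) (rule exI, erule order_trans, simp)
  qed (use r in simp)
qed

text \<open>The codewords do not enter the test. Averaged over codebooks, a competing cloud element
  equals a typical \<open>y\<close> with probability \<open>iid_prob T n y\<close>, at most
  \<open>exp (- n r)\<close>. The union bound runs over whole clouds, which accounts for the loss of
  \<open>K\<close>.\<close>

lemma achievable_below_output_entropy:
  fixes W :: "'a::finite \<Rightarrow> 'b::finite \<Rightarrow> real"
  assumes W: "stochastic_channel W" and P: "P \<in> input_dists"
    and "0 \<le> K" "0 \<le> R" and R: "R < entropy_fin (out_dist P W) - K"
  shows "achievable W K R"
proof -
  define T where "T = out_dist P W"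
  define r where "r = (R + K + entropy_fin T) / 2"
  have r: "R + K < r" "r < entropy_fin T" using R by (auto simp: r_def T_def)
  have Td: "T \<in> input_dists" unfolding T_def by (rule out_dist_input_dists[OF P W])
  define g where "g y = r + ln (T y)" for y
  have "(\<Sum>y\<in>UNIV. T y * g y) = r * (\<Sum>y\<in>UNIV. T y) - entropy_fin T"
    unfolding entropy_fin_eq sum_distrib_left sum_subtractf[symmetric]
    by (intro sum.cong refl) (auto simp: g_def algebra_simps)
  also have "\<dots> < 0" using Td r by (simp add: input_dists_def)
  finally obtain \<rho> where \<rho>: "0 \<le> \<rho>" "\<rho> < 1"
    and tail: "\<And>n. (\<Sum>y\<in>seqs n. iid_prob T n y * of_bool (0 \<le> (\<Sum>i<n. g (y i)))) \<le> \<rho> ^ n"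
    using iid_tail[OF Td, of g] by blast
  show ?thesis
  proof (rule achievableI[OF W tail_plus_exp_tendsto_0[OF \<rho>, of "r - (R + K)"]])
    fix n
    define t where "t y \<longleftrightarrow> iid_prob T n y \<le> exp (- (real n * r))" for y
    let ?M = "num_of R n" and ?N = "num_of K n"
    have atypical: "(\<Sum>y\<in>seqs n. iid_prob T n y * of_bool (\<not> t y)) \<le> \<rho> ^ n"
    proof (rule order_trans[OF sum_mono tail])
      fix y
      show "iid_prob T n y * of_bool (\<not> t y) \<le> iid_prob T n y * of_bool (0 \<le> (\<Sum>i<n. g (y i)))"
      proof (cases "t y")
        case False
        then have gt: "exp (- (real n * r)) < iid_prob T n y" by (simp add: t_def)
        then have "0 < iid_prob T n y" by (meson exp_gt_zero less_trans)
        then have "T (y i) \<noteq> 0" if "i < n" for i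
          using that less_imp_neq[of 0 "iid_prob T n y"] by (auto simp: iid_prob_def)
        then have Tp: "0 < T (y i)" if "i < n" for i
          using that input_dists_le_1(1)[OF Td] by (simp add: less_le)
        then have "(\<Sum>i<n. ln (T (y i))) = ln (iid_prob T n y)"
          by (intro ln_iid_prob(2)[symmetric])
        moreover have "- (real n * r) \<le> ln (iid_prob T n y)"
          using gt \<open>0 < iid_prob T n y\<close> by (simp add: ln_ge_iff)
        ultimately have "0 \<le> (\<Sum>i<n. g (y i))" by (simp add: g_def sum.distrib)
        then show ?thesis using iid_prob_nonneg[OF Td] by simp
      qed (use iid_prob_nonneg[OF Td] in auto)
    qed
    have collision: "(\<Sum>x\<in>seqs n. \<Sum>x'\<in>seqs n. iid_prob P n x * iid_prob P n x' *
        (\<Sum>y\<in>seqs n. seq_prob W n x y * seq_prob W n x' y * of_bool (t y))) \<le> exp (- (real n * r))"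
    proof -
      have "(\<Sum>x\<in>seqs n. \<Sum>x'\<in>seqs n. iid_prob P n x * iid_prob P n x' *
          (\<Sum>y\<in>seqs n. seq_prob W n x y * seq_prob W n x' y * of_bool (t y)))
        = (\<Sum>x\<in>seqs n. \<Sum>y\<in>seqs n. \<Sum>x'\<in>seqs n. iid_prob P n x * seq_prob W n x y *
            (iid_prob P n x' * seq_prob W n x' y * of_bool (t y)))"
        unfolding sum_distrib_left
        by (rule sum.cong[OF refl], subst sum.swap) (simp add: mult_ac)
      also have "\<dots> = (\<Sum>y\<in>seqs n. \<Sum>x\<in>seqs n. \<Sum>x'\<in>seqs n. iid_prob P n x * seq_prob W n x y *
            (iid_prob P n x' * seq_prob W n x' y * of_bool (t y)))"
        by (rule sum.swap)
      also have "\<dots> = (\<Sum>y\<in>seqs n. iid_prob T n y * (iid_prob T n y * of_bool (t y)))"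
        unfolding sum_distrib_left[symmetric] sum_distrib_right[symmetric] sum_iid_seq_prob T_def[symmetric] ..
      also have "\<dots> \<le> (\<Sum>y\<in>seqs n. iid_prob T n y * exp (- (real n * r)))"
        by (intro sum_mono mult_left_mono iid_prob_nonneg[OF Td]) (auto simp: of_bool_def t_def)
      also have "\<dots> = exp (- (real n * r))"
        by (simp add: sum_distrib_right[symmetric] sum_iid_prob[OF Td])
      finally show ?thesis .
    qed
    have "\<exists>c. ml_error W n ?M ?N c \<le> \<rho> ^ n + real ?M * (real ?N * exp (- (real n * r)))"
    proof (rule random_coding[OF W P num_of_pos num_of_pos,
          where a = "\<lambda>c Y m y. t y \<and> (\<exists>j<num_of K n. Y (m, j) = y)"])
      fix m j assume m: "m < ?M" "j < ?N"
      \<comment> \<open>The received vector lies in its own cloud, so only atypicality can cause a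
        miss.\<close>
      have *: "(\<not> (t (Y (m, j)) \<and> (\<exists>j'<?N. Y (m, j') = Y (m, j)))) \<longleftrightarrow> \<not> t (Y (m, j))" for Y :: "nat \<times> nat \<Rightarrow> nat \<Rightarrow> 'b"
        using m by auto
      have "(\<Sum>c\<in>codebooks n ?M. codebook_prob P n ?M c *
          (\<Sum>Y\<in>instances n ?M ?N. inst_prob W n ?M ?N c Y * of_bool (\<not> t (Y (m, j)))))
        = (\<Sum>x\<in>seqs n. \<Sum>y\<in>seqs n. iid_prob P n x * seq_prob W n x y * of_bool (\<not> t y))"
        using codebook_marginal[OF P m(1), where g = "\<lambda>x. \<Sum>y\<in>seqs n. seq_prob W n x y * of_bool (\<not> t y)"]
        unfolding inst_marginal[OF W m, where g = "\<lambda>y. of_bool (\<not> t y)"]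
        by (simp add: sum_distrib_left mult.assoc del: sum_mult_of_bool_eq)
      also have "\<dots> = (\<Sum>y\<in>seqs n. iid_prob T n y * of_bool (\<not> t y))"
        by (subst sum.swap) (simp add: sum_distrib_right[symmetric] sum_iid_seq_prob T_def del: sum_mult_of_bool_eq)
      finally show "(\<Sum>c\<in>codebooks n ?M. codebook_prob P n ?M c *
          (\<Sum>Y\<in>instances n ?M ?N. inst_prob W n ?M ?N c Y *
            of_bool (\<not> (t (Y (m, j)) \<and> (\<exists>j'<?N. Y (m, j') = Y (m, j)))))) \<le> \<rho> ^ n"
        unfolding * using atypical by simp
    next
      fix m m' j assume m: "m < ?M" "m' < ?M" "m \<noteq> m'" "j < ?N"
      \<comment> \<open>Coincidence with one competing cloud element. The union bound over the cloud
        reduces the event to two independent sequences, which belong to different messages.\<close>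
      define G where "G y z = (of_bool (t y \<and> z = y) :: real)" for y z :: "nat \<Rightarrow> 'b"
      have "(\<Sum>c\<in>codebooks n ?M. codebook_prob P n ?M c *
          (\<Sum>Y\<in>instances n ?M ?N. inst_prob W n ?M ?N c Y *
            of_bool (t (Y (m, j)) \<and> (\<exists>j'<?N. Y (m', j') = Y (m, j)))))
        \<le> (\<Sum>c\<in>codebooks n ?M. codebook_prob P n ?M c *
          (\<Sum>Y\<in>instances n ?M ?N. inst_prob W n ?M ?N c Y * (\<Sum>j'<?N. G (Y (m, j)) (Y (m', j')))))"
      proof (intro sum_mono mult_left_mono codebook_prob_nonneg[OF P] inst_prob_nonneg[OF W])
        fix Y :: "nat \<times> nat \<Rightarrow> nat \<Rightarrow> 'b"
        show "of_bool (t (Y (m, j)) \<and> (\<exists>j'<?N. Y (m', j') = Y (m, j))) \<le> (\<Sum>j'<?N. G (Y (m, j)) (Y (m', j')))"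
        proof (cases "t (Y (m, j)) \<and> (\<exists>j'<?N. Y (m', j') = Y (m, j))")
          case True
          then obtain j' where "j' < ?N" "G (Y (m, j)) (Y (m', j')) = 1" by (auto simp: G_def)
          moreover from this have "G (Y (m, j)) (Y (m', j')) \<le> (\<Sum>j'<?N. G (Y (m, j)) (Y (m', j')))"
            by (intro member_le_sum) (auto simp: G_def)
          ultimately show ?thesis by simp
        qed (auto simp: G_def intro!: sum_nonneg)
      qed
      also have "\<dots> = (\<Sum>j'<?N. \<Sum>c\<in>codebooks n ?M. codebook_prob P n ?M c *
          (\<Sum>Y\<in>instances n ?M ?N. inst_prob W n ?M ?N c Y * G (Y (m, j)) (Y (m', j'))))"
        unfolding sum_distrib_left sum.swap[of _ _ "{..<?N}"] ..
      also have "\<dots> \<le> (\<Sum>j'<?N. exp (- (real n * r)))"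
      proof (rule sum_mono)
        fix j' assume "j' \<in> {..<?N}"
        have G: "(\<Sum>y\<in>seqs n. \<Sum>z\<in>seqs n. seq_prob W n x y * seq_prob W n x' z * G y z)
            = (\<Sum>y\<in>seqs n. seq_prob W n x y * seq_prob W n x' y * of_bool (t y))" for x x'
        proof (rule sum.cong[OF refl])
          fix y :: "nat \<Rightarrow> 'b" assume "y \<in> seqs n"
          then have "(\<Sum>z\<in>seqs n. seq_prob W n x y * seq_prob W n x' z * G y z)
              = (\<Sum>z\<in>{y}. seq_prob W n x y * seq_prob W n x' z * G y z)"
            by (intro sum.mono_neutral_right) (auto simp: G_def)
          then show "(\<Sum>z\<in>seqs n. seq_prob W n x y * seq_prob W n x' z * G y z)
              = seq_prob W n x y * seq_prob W n x' y * of_bool (t y)"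
            by (simp add: G_def)
        qed
        show "(\<Sum>c\<in>codebooks n ?M. codebook_prob P n ?M c *
          (\<Sum>Y\<in>instances n ?M ?N. inst_prob W n ?M ?N c Y * G (Y (m, j)) (Y (m', j')))) \<le> exp (- (real n * r))"
          using collision \<open>j' \<in> _\<close> codebook_marginal2[OF P m(1-3),
            where G = "\<lambda>x x'. \<Sum>y\<in>seqs n. seq_prob W n x y * seq_prob W n x' y * of_bool (t y)"]
          by (simp add: inst_marginal2[OF W m(1,4,2) _ m(3), where G = G] G del: sum_mult_of_bool_eq)
      qed
      also have "\<dots> = real ?N * exp (- (real n * r))" by simp
      finally show "(\<Sum>c\<in>codebooks n ?M. codebook_prob P n ?M c *
          (\<Sum>Y\<in>instances n ?M ?N. inst_prob W n ?M ?N c Y *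
            of_bool (t (Y (m, j)) \<and> (\<exists>j'<?N. Y (m', j') = Y (m, j)))))
        \<le> real ?N * exp (- (real n * r))" .
    qed (use assms in auto)
    moreover have "real ?M * (real ?N * exp (- (real n * r))) \<le> exp (- (real n * (r - (R + K))))"
    proof -
      have "real ?M * real ?N \<le> exp (real n * R) * exp (real n * K)"
        by (intro mult_mono num_of_le) auto
      from mult_right_mono[OF this, of "exp (- (real n * r))"] show ?thesis
        by (simp add: exp_add[symmetric] algebra_simps)
    qed
    ultimately show "\<exists>c. ml_error W n ?M ?N c \<le> \<rho> ^ n + exp (- (real n * (r - (R + K))))"
      by (elim exE) (rule exI, erule order_trans, simp)
  qed (use r in simp)
qed

subsection \<open>Converse\<close>

text \<open>The count is binomial with parameters \<open>N\<close> and \<open>w\<close>, so its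
  moment generating function at 1 is \<open>(1 + (exp 1 - 1) * w) ^ N\<close>. The factor 2 comes
  from \<open>exp 1 \<le> 3\<close>.\<close>

lemma expectation_exp_copies_le:
  fixes W :: "'a::finite \<Rightarrow> 'b::finite \<Rightarrow> real"
  assumes W: "stochastic_channel W" and "m < M" "y \<in> seqs n"
  shows "(\<Sum>Y\<in>instances n M N. inst_prob W n M N c Y * exp (real (copies N Y m y)))
    \<le> exp (2 * real N * seq_prob W n (c m) y)"
proof -
  define w where "w = seq_prob W n (c m) y"
  have w: "0 \<le> w" unfolding w_def by (rule seq_prob_nonneg[OF W])
  \<comment> \<open>Each element of the cloud of \<open>m\<close> that equals \<open>y\<close>
    contributes \<open>exp 1\<close>, everything else 1. This turns the exponential of the count
    into a product over the whole instance.\<close>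
  define h where "h m' z = (if m' = m then if z = y then exp 1 else 1 else (1::real))" for m' and z :: "nat \<Rightarrow> 'b"
  have prod_if: "(\<Prod>mj\<in>{..<M} \<times> {..<N}. if fst mj = m then f (snd mj) else 1) = (\<Prod>j<N. f j)" for f :: "nat \<Rightarrow> real"
  proof -
    have "(\<Prod>mj\<in>{..<M} \<times> {..<N}. if fst mj = m then f (snd mj) else 1)
        = (\<Prod>m'<M. \<Prod>j<N. if m' = m then f j else 1)"
      by (simp add: prod.cartesian_product case_prod_unfold)
    also have "\<dots> = (\<Prod>m'<M. if m' = m then \<Prod>j<N. f j else 1)"
      by (intro prod.cong) auto
    finally show ?thesis using \<open>m < M\<close> by simp
  qed
  have "exp (real (copies N Y m y)) = (\<Prod>mj\<in>{..<M} \<times> {..<N}. h (fst mj) (Y mj))" for Y :: "nat \<times> nat \<Rightarrow> nat \<Rightarrow> 'b"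
  proof -
    have "real (copies N Y m y) = (\<Sum>j<N. if Y (m, j) = y then 1 else 0)"
      by (simp add: copies_def sum.If_cases Int_def)
    then have "exp (real (copies N Y m y)) = (\<Prod>j<N. if Y (m, j) = y then exp 1 else 1)"
      by (simp add: exp_sum if_distrib[of exp] cong: if_cong)
    also have "\<dots> = (\<Prod>mj\<in>{..<M} \<times> {..<N}. h (fst mj) (Y mj))"
      unfolding prod_if[symmetric] by (intro prod.cong) (auto simp: h_def)
    finally show ?thesis .
  qed
  then have "(\<Sum>Y\<in>instances n M N. inst_prob W n M N c Y * exp (real (copies N Y m y)))
      = (\<Sum>Y\<in>instances n M N. \<Prod>mj\<in>{..<M} \<times> {..<N}. seq_prob W n (c (fst mj)) (Y mj) * h (fst mj) (Y mj))"
    by (simp add: inst_prob_eq prod.distrib)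
  also have "\<dots> = (\<Prod>mj\<in>{..<M} \<times> {..<N}. \<Sum>z\<in>seqs n. seq_prob W n (c (fst mj)) z * h (fst mj) z)"
    unfolding instances_def
    by (subst prod_sum_PiE[where f = "\<lambda>mj z. seq_prob W n (c (fst mj)) z * h (fst mj) z"]) auto
  also have "\<dots> = (\<Prod>mj\<in>{..<M} \<times> {..<N}. if fst mj = m then 1 + (exp 1 - 1) * w else 1)"
  proof (intro prod.cong refl)
    fix mj :: "nat \<times> nat"
    have "(\<Sum>z\<in>seqs n. seq_prob W n (c m) z * h m z)
        = (\<Sum>z\<in>seqs n. seq_prob W n (c m) z + (if z = y then (exp 1 - 1) * w else 0))"
      by (intro sum.cong) (auto simp: h_def w_def algebra_simps)
    also have "\<dots> = 1 + (exp 1 - 1) * w"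
      using \<open>y \<in> seqs n\<close> by (simp add: sum.distrib sum_seq_prob[OF W])
    finally show "(\<Sum>z\<in>seqs n. seq_prob W n (c (fst mj)) z * h (fst mj) z)
      = (if fst mj = m then 1 + (exp 1 - 1) * w else 1)"
      by (auto simp: h_def sum_seq_prob[OF W])
  qed
  also have "\<dots> = (1 + (exp 1 - 1) * w) ^ N"
    using prod_if[of "\<lambda>_. 1 + (exp 1 - 1) * w"] by simp
  also have "\<dots> \<le> exp (2 * w) ^ N"
  proof (intro power_mono)
    have "(exp 1 - 1) * w \<le> 2 * w" using exp_le w by (intro mult_right_mono) auto
    also have "1 + 2 * w \<le> exp (2 * w)" by (rule exp_ge_add_one_self)
    finally show "1 + (exp 1 - 1) * w \<le> exp (2 * w)" by simp
    have "(1::real) \<le> exp 1" by simp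
    then show "0 \<le> 1 + (exp 1 - 1) * w" using w by (intro add_nonneg_nonneg mult_nonneg_nonneg) auto
  qed
  also have "\<dots> = exp (2 * real N * w)"
    using exp_of_nat_mult[of N "2 * w"] by (simp add: mult_ac)
  finally show ?thesis by (simp add: w_def)
qed

text \<open>Bounding the largest count by a multiple of the sum of the exponentials of all counts
  replaces a concentration argument: the maximum of the counts costs only \<open>ln M\<close>
  on top of twice the largest mean.\<close>

lemma expectation_winning_copies_le:
  fixes W :: "'a::finite \<Rightarrow> 'b::finite \<Rightarrow> real"
  assumes W: "stochastic_channel W" and "S \<subseteq> {..<M}" "S \<noteq> {}" "y \<in> seqs n"
    and q: "\<And>m. m \<in> S \<Longrightarrow> seq_prob W n (c m) y \<le> q"
  shows "(\<Sum>Y\<in>instances n M N. inst_prob W n M N c Y *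
      (\<Sum>m\<in>S. real (copies N Y m y) * ml_correct M N Y m y)) \<le> ln (real M) + 2 * real N * q"
proof -
  have "finite S" using assms by (meson finite_lessThan finite_subset)
  have M: "0 < M" using assms by auto
  \<comment> \<open>A bound for the expected sum of the exponentials of the counts: at most
    \<open>M\<close> terms, each at most \<open>exp (2 N q)\<close>.\<close>
  define a where "a = real M * exp (2 * real N * q)"
  have a: "0 < a" "ln a = ln (real M) + 2 * real N * q"
    using M by (auto simp: a_def ln_mult)
  define e where "e Y m = exp (real (copies N Y m y))" for Y m
  \<comment> \<open>The tangent of \<open>exp\<close> at \<open>ln a\<close> gives
    \<open>u \<le> exp u / a - 1 + ln a\<close> for every count \<open>u\<close>. This is linear in
    the exponentials, so its expectation is at most \<open>ln a\<close>.\<close>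
  define r where "r Y = (\<Sum>m\<in>S. e Y m) / a - 1 + ln a" for Y
  have r: "real (copies N Y m y) \<le> r Y" if "m \<in> S" for Y m
  proof -
    have "1 + (real (copies N Y m y) - ln a) \<le> exp (real (copies N Y m y) - ln a)"
      by (rule exp_ge_add_one_self)
    also have "\<dots> = e Y m / a" using a(1) by (simp add: exp_diff e_def)
    also have "\<dots> \<le> (\<Sum>m\<in>S. e Y m) / a"
      using a that \<open>finite S\<close> by (intro divide_right_mono member_le_sum) (auto simp: e_def)
    finally show ?thesis by (simp add: r_def)
  qed
  have "(\<Sum>m\<in>S. real (copies N Y m y) * ml_correct M N Y m y) \<le> r Y" for Y
  proof -
    obtain m where "m \<in> S" using \<open>S \<noteq> {}\<close> by auto
    then have "0 \<le> r Y" using order_trans[OF of_nat_0_le_iff r] by blast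
    have "(\<Sum>m\<in>S. real (copies N Y m y) * ml_correct M N Y m y) \<le> (\<Sum>m\<in>S. r Y * ml_correct M N Y m y)"
      by (intro sum_mono mult_right_mono r ml_correct_nonneg)
    also have "\<dots> = r Y * (\<Sum>m\<in>S. ml_correct M N Y m y)" by (simp add: sum_distrib_left)
    also have "\<dots> \<le> r Y * 1"
      using \<open>0 \<le> r Y\<close> \<open>S \<subseteq> {..<M}\<close>
      by (intro mult_left_mono order_trans[OF sum_mono2 sum_ml_correct_le]) (auto simp: ml_correct_nonneg)
    finally show ?thesis by simp
  qed
  then have "(\<Sum>Y\<in>instances n M N. inst_prob W n M N c Y *
      (\<Sum>m\<in>S. real (copies N Y m y) * ml_correct M N Y m y)) \<le> (\<Sum>Y\<in>instances n M N. inst_prob W n M N c Y * r Y)"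
    by (intro sum_mono mult_left_mono inst_prob_nonneg[OF W])
  also have "\<dots> = (\<Sum>Y\<in>instances n M N. inst_prob W n M N c Y * (\<Sum>m\<in>S. e Y m)) / a
      + (\<Sum>Y\<in>instances n M N. inst_prob W n M N c Y) * (ln a - 1)"
    unfolding r_def sum_divide_distrib[of _ "instances n M N"] sum_distrib_right sum.distrib[symmetric]
    by (intro sum.cong refl) (simp add: algebra_simps)
  also have "(\<Sum>Y\<in>instances n M N. inst_prob W n M N c Y * (\<Sum>m\<in>S. e Y m))
      = (\<Sum>m\<in>S. \<Sum>Y\<in>instances n M N. inst_prob W n M N c Y * e Y m)"
    unfolding sum_distrib_left by (rule sum.swap)
  also have "(\<Sum>m\<in>S. \<Sum>Y\<in>instances n M N. inst_prob W n M N c Y * e Y m) / a \<le> 1"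
  proof -
    have "(\<Sum>Y\<in>instances n M N. inst_prob W n M N c Y * e Y m) \<le> exp (2 * real N * q)" if "m \<in> S" for m
    proof -
      have "(\<Sum>Y\<in>instances n M N. inst_prob W n M N c Y * e Y m) \<le> exp (2 * real N * seq_prob W n (c m) y)"
        unfolding e_def using that assms by (intro expectation_exp_copies_le) auto
      also have "\<dots> \<le> exp (2 * real N * q)" using q[OF that] by (simp add: mult_left_mono)
      finally show ?thesis .
    qed
    then have "(\<Sum>m\<in>S. \<Sum>Y\<in>instances n M N. inst_prob W n M N c Y * e Y m) \<le> real (card S) * exp (2 * real N * q)"
      by (rule sum_bounded_above)
    also have "\<dots> \<le> a"
      unfolding a_def using card_mono[OF _ \<open>S \<subseteq> {..<M}\<close>] by (intro mult_right_mono) auto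
    finally show ?thesis using a by simp
  qed
  finally show ?thesis using a by (simp add: sum_inst_prob[OF W])
qed

text \<open>Cloud elements that fail \<open>t\<close> are conceded as correct at cost \<alpha>. The
  rest is regrouped by \<open>y\<close>, and each \<open>y\<close> in \<open>A\<close> yields at
  most \<open>ln M + 2 N q y\<close> correctly decoded cloud elements on average.\<close>

lemma ml_success_le:
  fixes W :: "'a::finite \<Rightarrow> 'b::finite \<Rightarrow> real"
  assumes W: "stochastic_channel W" and "0 < M" "0 < N" and "A \<subseteq> seqs n"
    and conf: "\<And>m y. m < M \<Longrightarrow> y \<in> seqs n \<Longrightarrow> t m y \<Longrightarrow> y \<in> A \<and> seq_prob W n (c m) y \<le> q y"
    and q: "\<And>y. 0 \<le> q y"
    and atyp: "\<And>m. m < M \<Longrightarrow> (\<Sum>y\<in>seqs n. seq_prob W n (c m) y * of_bool (\<not> t m y)) \<le> \<alpha>"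
  shows "1 - ml_error W n M N c \<le> \<alpha> + (real (card A) * ln (real M) + 2 * real N * (\<Sum>y\<in>A. q y)) / (real M * real N)"
proof -
  let ?I = "instances n M N :: (nat \<times> nat \<Rightarrow> nat \<Rightarrow> 'b) set"
  let ?p = "inst_prob W n M N c"
  define D where "D Y m y = ml_correct M N Y m y" for Y :: "nat \<times> nat \<Rightarrow> nat \<Rightarrow> 'b" and m y
  define S where "S y = {m. m < M \<and> t m y}" for y
  define k where "k Y m y = real (copies N Y m y) * D Y m y" for Y m y
  have "finite A" using \<open>A \<subseteq> seqs n\<close> finite_seqs by (rule finite_subset)
  have split: "(\<Sum>m<M. \<Sum>j<N. D Y m (Y (m, j)))
      \<le> (\<Sum>m<M. \<Sum>j<N. of_bool (\<not> t m (Y (m, j)))) + (\<Sum>y\<in>seqs n. \<Sum>m\<in>S y. k Y m y)"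
    if Y: "Y \<in> ?I" for Y
  proof -
    have "(\<Sum>m<M. \<Sum>j<N. D Y m (Y (m, j)))
        \<le> (\<Sum>m<M. \<Sum>j<N. of_bool (\<not> t m (Y (m, j))) + of_bool (t m (Y (m, j))) * D Y m (Y (m, j)))"
      by (intro sum_mono) (auto simp: D_def of_bool_def ml_correct_le)
    also have "\<dots> = (\<Sum>m<M. \<Sum>j<N. of_bool (\<not> t m (Y (m, j)))) + (\<Sum>m<M. \<Sum>j<N. of_bool (t m (Y (m, j))) * D Y m (Y (m, j)))"
      by (simp only: sum.distrib)
    also have "(\<Sum>m<M. \<Sum>j<N. of_bool (t m (Y (m, j))) * D Y m (Y (m, j)))
        = (\<Sum>m<M. \<Sum>y\<in>seqs n. real (copies N Y m y) * (of_bool (t m y) * D Y m y))"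
      by (intro sum.cong refl, rule sum_cloud_eq_sum_copies[OF Y]) simp
    also have "\<dots> = (\<Sum>y\<in>seqs n. \<Sum>m<M. real (copies N Y m y) * (of_bool (t m y) * D Y m y))"
      by (rule sum.swap)
    also have "\<dots> = (\<Sum>y\<in>seqs n. \<Sum>m\<in>S y. k Y m y)"
      by (intro sum.cong refl sum.mono_neutral_cong_right) (auto simp: S_def k_def)
    finally show ?thesis .
  qed
  have "1 - ml_error W n M N c = (\<Sum>Y\<in>?I. ?p Y * (\<Sum>m<M. \<Sum>j<N. D Y m (Y (m, j)))) / (real M * real N)"
    unfolding ml_error_def D_def sum_divide_distrib[symmetric] times_divide_eq_right by simp
  also have "\<dots> \<le> (real M * real N * \<alpha> + (real (card A) * ln (real M) + 2 * real N * (\<Sum>y\<in>A. q y))) / (real M * real N)"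
  proof (rule divide_right_mono)
    have "(\<Sum>Y\<in>?I. ?p Y * (\<Sum>m<M. \<Sum>j<N. D Y m (Y (m, j))))
        \<le> (\<Sum>Y\<in>?I. ?p Y * ((\<Sum>m<M. \<Sum>j<N. of_bool (\<not> t m (Y (m, j)))) + (\<Sum>y\<in>seqs n. \<Sum>m\<in>S y. k Y m y)))"
      by (intro sum_mono mult_left_mono split inst_prob_nonneg[OF W])
    also have "\<dots> = (\<Sum>Y\<in>?I. \<Sum>m<M. \<Sum>j<N. ?p Y * of_bool (\<not> t m (Y (m, j))))
        + (\<Sum>Y\<in>?I. \<Sum>y\<in>seqs n. ?p Y * (\<Sum>m\<in>S y. k Y m y))"
      by (simp only: distrib_left sum.distrib sum_distrib_left)
    also have "(\<Sum>Y\<in>?I. \<Sum>m<M. \<Sum>j<N. ?p Y * of_bool (\<not> t m (Y (m, j))))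
        = (\<Sum>m<M. \<Sum>j<N. \<Sum>Y\<in>?I. ?p Y * of_bool (\<not> t m (Y (m, j))))"
      by (subst sum.swap, rule sum.cong[OF refl], rule sum.swap)
    also have "\<dots> \<le> (\<Sum>m<M. \<Sum>j<N. \<alpha>)"
    proof (intro sum_mono)
      fix m j assume "m \<in> {..<M}" "j \<in> {..<N}"
      then have m: "m < M" "j < N" by auto
      show "(\<Sum>Y\<in>?I. ?p Y * of_bool (\<not> t m (Y (m, j)))) \<le> \<alpha>"
        unfolding inst_marginal[OF W m, where g = "\<lambda>y. of_bool (\<not> t m y)"] by (rule atyp[OF m(1)])
    qed
    also have "(\<Sum>m<M. \<Sum>j<N. \<alpha>) = real M * real N * \<alpha>" by simp
    also have "(\<Sum>Y\<in>?I. \<Sum>y\<in>seqs n. ?p Y * (\<Sum>m\<in>S y. k Y m y))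
        = (\<Sum>y\<in>seqs n. \<Sum>Y\<in>?I. ?p Y * (\<Sum>m\<in>S y. k Y m y))"
      by (rule sum.swap)
    \<comment> \<open>Outside \<open>A\<close> no message passes \<open>t\<close>, so
      \<open>ln M\<close> is charged once per element of \<open>A\<close> and not for all of
      \<open>seqs n\<close>.\<close>
    also have "\<dots> = (\<Sum>y\<in>A. \<Sum>Y\<in>?I. ?p Y * (\<Sum>m\<in>S y. k Y m y))"
    proof (intro sum.mono_neutral_right ballI)
      fix y assume "y \<in> seqs n - A"
      then have "S y = {}" using conf by (auto simp: S_def)
      then show "(\<Sum>Y\<in>?I. ?p Y * (\<Sum>m\<in>S y. k Y m y)) = 0" by simp
    qed (use \<open>A \<subseteq> seqs n\<close> in auto)
    also have "\<dots> \<le> (\<Sum>y\<in>A. ln (real M) + 2 * real N * q y)"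
    proof (rule sum_mono)
      fix y assume "y \<in> A"
      then have y: "y \<in> seqs n" using \<open>A \<subseteq> seqs n\<close> by auto
      show "(\<Sum>Y\<in>?I. ?p Y * (\<Sum>m\<in>S y. k Y m y)) \<le> ln (real M) + 2 * real N * q y"
      proof (cases "S y = {}")
        case True
        then show ?thesis using q[of y] \<open>0 < M\<close> by simp
      next
        case False
        then show ?thesis
          unfolding k_def D_def using conf y
          by (intro expectation_winning_copies_le[OF W]) (auto simp: S_def)
      qed
    qed
    also have "\<dots> = real (card A) * ln (real M) + 2 * real N * (\<Sum>y\<in>A. q y)"
      by (simp add: sum.distrib sum_distrib_left)
    finally show "(\<Sum>Y\<in>?I. ?p Y * (\<Sum>m<M. \<Sum>j<N. D Y m (Y (m, j))))
        \<le> real M * real N * \<alpha> + (real (card A) * ln (real M) + 2 * real N * (\<Sum>y\<in>A. q y))"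
      by simp
  qed simp
  also have "\<dots> = \<alpha> + (real (card A) * ln (real M) + 2 * real N * (\<Sum>y\<in>A. q y)) / (real M * real N)"
    using \<open>0 < M\<close> \<open>0 < N\<close> by (simp add: add_divide_distrib)
  finally show ?thesis .
qed

text \<open>For larger \<open>R\<close> the success probability of any codebooks tends to 0, a
  strong converse; achievability requires it to tend to 1.\<close>

lemma achievable_le:
  fixes W :: "'a::finite \<Rightarrow> 'b::finite \<Rightarrow> real"
  assumes W: "stochastic_channel W" and "0 < K" "0 < R" and ach: "achievable W K R"
  shows "R \<le> max (shannon_capacity W) (H_max W - K)"
proof (rule ccontr)
  assume "\<not> ?thesis"
  then have R: "shannon_capacity W < R" "H_max W < R + K" by auto
  \<comment> \<open>Half of the smaller gap: one \<open>d\<close> widens the thresholds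
    \<open>H\<close> and \<open>C\<close>, another remains as the exponent of decay.\<close>
  define d where "d = min (R - shannon_capacity W) (R + K - H_max W) / 2"
  have d: "0 < d" "shannon_capacity W + 2 * d \<le> R" "H_max W + 2 * d \<le> R + K"
    using R by (auto simp: d_def min_def)
  define C where "C = shannon_capacity W + d"
  define H where "H = H_max W + d"
  obtain P1 where P1: "P1 \<in> input_dists" "\<And>x y. 0 < W x y \<Longrightarrow> 0 < out_dist P1 W y"
    "\<And>x. (\<Sum>y\<in>UNIV. W x y * (- ln (out_dist P1 W y))) \<le> H_max W"
    using H_max_attained[OF W] by metis
  obtain P2 where P2: "P2 \<in> input_dists" "\<And>x y. 0 < W x y \<Longrightarrow> 0 < out_dist P2 W y"
    "\<And>x. (\<Sum>y\<in>UNIV. W x y * (- ln (out_dist P2 W y))) - entropy_fin (W x) \<le> shannon_capacity W"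
    using shannon_capacity_attained[OF W] by metis
  define T where "T = out_dist P1 W"
  define U where "U = out_dist P2 W"
  have Td: "T \<in> input_dists" and Ud: "U \<in> input_dists"
    unfolding T_def U_def by (intro out_dist_input_dists P1(1) P2(1) W)+
  have W1: "(\<Sum>y\<in>UNIV. W x y) = 1" and Wnn: "0 \<le> W x y" for x y
    using W by (auto simp: stochastic_channel_def)
  \<comment> \<open>For each input letter, \<open>g\<close> and \<open>h\<close> have mean at most
    \<open>- d\<close> by the optimality conditions of \<open>P1\<close> and \<open>P2\<close>. A
    nonnegative sum of \<open>g\<close> signals an output too improbable under \<open>T\<close>, one
    of \<open>h\<close> a likelihood too large compared with \<open>U\<close>.\<close>
  define g where "g x y = - ln (T y) - H" for x :: 'a and y
  define h where "h x y = ln (W x y) - ln (U y) - C" for x y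
  have "(\<Sum>y\<in>UNIV. W x y * g x y) = (\<Sum>y\<in>UNIV. W x y * (- ln (T y))) - H * (\<Sum>y\<in>UNIV. W x y)" for x
    unfolding sum_distrib_left sum_subtractf[symmetric]
    by (intro sum.cong refl) (simp add: g_def algebra_simps)
  then have "(\<Sum>y\<in>UNIV. W x y * g x y) < 0" for x
    using P1(3)[of x] d by (simp add: W1 T_def H_def)
  then obtain \<rho>1 where \<rho>1: "0 \<le> \<rho>1" "\<rho>1 < 1" and tail1:
    "\<And>n x. (\<Sum>y\<in>seqs n. seq_prob W n x y * of_bool (0 \<le> (\<Sum>i<n. g (x i) (y i)))) \<le> \<rho>1 ^ n"
    using channel_tail[OF W, of g] by blast
  have "(\<Sum>y\<in>UNIV. W x y * h x y)
      = (\<Sum>y\<in>UNIV. W x y * (- ln (U y))) - entropy_fin (W x) - C * (\<Sum>y\<in>UNIV. W x y)" for x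
    unfolding sum_distrib_left sum_subtractf[symmetric] entropy_fin_eq
    by (intro sum.cong refl) (simp add: h_def algebra_simps)
  then have "(\<Sum>y\<in>UNIV. W x y * h x y) < 0" for x
    using P2(3)[of x] d by (simp add: W1 U_def C_def)
  then obtain \<rho>2 where \<rho>2: "0 \<le> \<rho>2" "\<rho>2 < 1" and tail2:
    "\<And>n x. (\<Sum>y\<in>seqs n. seq_prob W n x y * of_bool (0 \<le> (\<Sum>i<n. h (x i) (y i)))) \<le> \<rho>2 ^ n"
    using channel_tail[OF W, of h] by blast
  have bound: "1 - ml_error W n (num_of R n) (num_of K n) c
      \<le> \<rho>1 ^ n + \<rho>2 ^ n + 4 * R * (real n * exp (- d) ^ n) + 4 * exp (- d) ^ n" for n c
  proof -
    let ?M = "num_of R n" and ?N = "num_of K n"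
    have MN: "0 < ?M" "0 < ?N" using assms by (auto intro: num_of_pos)
    \<comment> \<open>Each member of \<open>A\<close> weighs at least \<open>exp (- n H)\<close>
      under \<open>T\<close>, so there are at most \<open>exp (n H)\<close> of them;
      \<open>q\<close> has total mass \<open>exp (n C)\<close> over all sequences.\<close>
    define A where "A = {y \<in> seqs n. exp (- (real n * H)) \<le> iid_prob T n y}"
    define q where "q y = exp (real n * C) * iid_prob U n y" for y
    have "finite A" by (simp add: A_def)
    have pointwise: "seq_prob W n (c m) y * of_bool (\<not> (exp (- (real n * H)) \<le> iid_prob T n y \<and> seq_prob W n (c m) y \<le> q y))
      \<le> seq_prob W n (c m) y * of_bool (0 \<le> (\<Sum>i<n. g (c m i) (y i)))
      + seq_prob W n (c m) y * of_bool (0 \<le> (\<Sum>i<n. h (c m i) (y i)))" for m y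
    proof (cases "0 < seq_prob W n (c m) y")
      case True
      then have Wp: "0 < W (c m i) (y i)" if "i < n" for i
        using that seq_prob_pos_iff[OF W] by blast
      have Tp: "0 < T (y i)" and Up: "0 < U (y i)" if "i < n" for i
        using P1(2) P2(2) Wp[OF that] by (auto simp: T_def U_def)
      note l = ln_iid_prob[of n T y, OF Tp] ln_iid_prob[of n U y, OF Up] ln_seq_prob[of n W "c m" y, OF Wp]
      have "0 \<le> (\<Sum>i<n. g (c m i) (y i))" if "\<not> exp (- (real n * H)) \<le> iid_prob T n y"
      proof -
        have "ln (iid_prob T n y) \<le> - (real n * H)"
          using that l(1) by (subst ln_exp[symmetric], subst ln_le_cancel_iff) auto
        then show ?thesis by (simp add: g_def l sum_subtractf sum_negf)
      qed
      moreover have "0 \<le> (\<Sum>i<n. h (c m i) (y i))" if "\<not> seq_prob W n (c m) y \<le> q y"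
      proof -
        have "0 < q y" using l by (simp add: q_def)
        then have "ln (q y) \<le> ln (seq_prob W n (c m) y)"
          using that True by (subst ln_le_cancel_iff) auto
        moreover have "ln (q y) = real n * C + (\<Sum>i<n. ln (U (y i)))"
          using l by (simp add: q_def ln_mult)
        ultimately show ?thesis by (simp add: h_def l sum_subtractf)
      qed
      ultimately show ?thesis using True by (auto simp: of_bool_def)
    next
      case False
      then have "seq_prob W n (c m) y = 0" using seq_prob_nonneg[OF W, of n "c m" y] by simp
      then show ?thesis by simp
    qed
    have "1 - ml_error W n ?M ?N c
        \<le> (\<rho>1 ^ n + \<rho>2 ^ n) + (real (card A) * ln (real ?M) + 2 * real ?N * (\<Sum>y\<in>A. q y)) / (real ?M * real ?N)"
    proof (rule ml_success_le[OF W MN,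
          where t = "\<lambda>m y. exp (- (real n * H)) \<le> iid_prob T n y \<and> seq_prob W n (c m) y \<le> q y"])
      show "A \<subseteq> seqs n" by (auto simp: A_def)
      show "0 \<le> q y" for y by (simp add: q_def iid_prob_nonneg[OF Ud])
      fix m
      have "(\<Sum>y\<in>seqs n. seq_prob W n (c m) y * of_bool (\<not> (exp (- (real n * H)) \<le> iid_prob T n y \<and> seq_prob W n (c m) y \<le> q y)))
        \<le> (\<Sum>y\<in>seqs n. seq_prob W n (c m) y * of_bool (0 \<le> (\<Sum>i<n. g (c m i) (y i)))
          + seq_prob W n (c m) y * of_bool (0 \<le> (\<Sum>i<n. h (c m i) (y i))))"
        by (intro sum_mono pointwise)
      also have "\<dots> \<le> \<rho>1 ^ n + \<rho>2 ^ n"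
        unfolding sum.distrib by (intro add_mono tail1 tail2)
      finally show "(\<Sum>y\<in>seqs n. seq_prob W n (c m) y * of_bool (\<not> (exp (- (real n * H)) \<le> iid_prob T n y \<and> seq_prob W n (c m) y \<le> q y)))
          \<le> \<rho>1 ^ n + \<rho>2 ^ n" .
    qed (auto simp: A_def)
    also have "(real (card A) * ln (real ?M) + 2 * real ?N * (\<Sum>y\<in>A. q y)) / (real ?M * real ?N)
        = real (card A) * ln (real ?M) * inverse (real ?M * real ?N) + 2 * (\<Sum>y\<in>A. q y) * inverse (real ?M)"
      using MN by (simp add: field_simps)
    \<comment> \<open>The factors 4 and 2 in parentheses undo the rounding of \<open>M N\<close> and
      \<open>M\<close>. The factor \<open>n R\<close> stems from \<open>ln M\<close> and is harmless
      against exponential decay.\<close>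
    also have "\<dots> \<le> exp (real n * H) * (real n * R) * (4 * exp (- (real n * (R + K))))
        + 2 * exp (real n * C) * (2 * exp (- (real n * R)))"
    proof (intro add_mono mult_mono)
      have "real (card A) * exp (- (real n * H)) \<le> (\<Sum>y\<in>A. iid_prob T n y)"
        by (rule sum_bounded_below) (simp add: A_def)
      also have "\<dots> \<le> (\<Sum>y\<in>seqs n. iid_prob T n y)"
        by (rule sum_mono2) (auto simp: A_def iid_prob_nonneg[OF Td])
      finally show "real (card A) \<le> exp (real n * H)"
        by (simp add: sum_iid_prob[OF Td] exp_minus field_simps)
      show "ln (real ?M) \<le> real n * R"
        using num_of_le[of R n] MN by (subst ln_exp[symmetric], subst ln_le_cancel_iff) auto
      have M: "exp (real n * R) \<le> 2 * real ?M" and N: "exp (real n * K) \<le> 2 * real ?N"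
        using assms by (auto intro: num_of_ge)
      show "inverse (real ?M) \<le> 2 * exp (- (real n * R))"
        using le_imp_inverse_le[OF M] by (simp add: exp_minus)
      moreover have "inverse (real ?N) \<le> 2 * exp (- (real n * K))"
        using le_imp_inverse_le[OF N] by (simp add: exp_minus)
      ultimately have "inverse (real ?M) * inverse (real ?N) \<le> (2 * exp (- (real n * R))) * (2 * exp (- (real n * K)))"
        by (intro mult_mono) auto
      also have "\<dots> = 4 * exp (- (real n * (R + K)))"
        by (simp add: exp_add[symmetric] algebra_simps)
      finally show "inverse (real ?M * real ?N) \<le> 4 * exp (- (real n * (R + K)))" by simp
      have "(\<Sum>y\<in>A. q y) \<le> exp (real n * C) * (\<Sum>y\<in>seqs n. iid_prob U n y)"
        unfolding sum_distrib_left q_def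
        by (rule sum_mono2) (auto simp: A_def iid_prob_nonneg[OF Ud])
      then show "(\<Sum>y\<in>A. q y) \<le> exp (real n * C)"
        by (simp add: sum_iid_prob[OF Ud])
    qed (use MN assms in \<open>auto simp: q_def iid_prob_nonneg[OF Ud] intro!: sum_nonneg\<close>)
    also have "\<dots> = 4 * R * real n * exp (- (real n * (R + K - H))) + 4 * exp (- (real n * (R - C)))"
      by (simp add: exp_add[symmetric] algebra_simps)
    also have "\<dots> \<le> 4 * R * real n * exp (- (real n * d)) + 4 * exp (- (real n * d))"
      using d assms by (intro add_mono mult_left_mono) (auto simp: C_def H_def intro!: mult_left_mono)
    also have "exp (- (real n * d)) = exp (- d) ^ n"
      using exp_of_nat_mult[of n "- d"] by simp
    finally show ?thesis by simp
  qed
  obtain c where c: "(\<lambda>n. ml_error W n (num_of R n) (num_of K n) (c n)) \<longlonglongrightarrow> 0"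
    using ach unfolding achievable_def by blast
  have "(\<lambda>n. \<rho>1 ^ n + \<rho>2 ^ n + 4 * R * (real n * exp (- d) ^ n) + 4 * exp (- d) ^ n) \<longlonglongrightarrow> 0 + 0 + 4 * R * 0 + 4 * 0"
    using \<rho>1 \<rho>2 d by (intro tendsto_intros LIMSEQ_realpow_zero powser_times_n_limit_0) auto
  moreover have "(\<lambda>n. 1 - ml_error W n (num_of R n) (num_of K n) (c n)) \<longlonglongrightarrow> 1 - 0"
    by (intro tendsto_intros c)
  ultimately have "(1::real) - 0 \<le> 0 + 0 + 4 * R * 0 + 4 * 0"
    using bound by (intro LIMSEQ_le) auto
  then show False by simp
qed

section \<open>The supremum of the achievable rates\<close>

theorem theorem3:
  fixes W :: "'a::finite \<Rightarrow> 'b::finite \<Rightarrow> real" and K :: real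
  assumes "stochastic_channel W" and "0 < K"
  shows "ensemble_capacity W K = max (shannon_capacity W) (H_max W - K)"
proof -
  note W = assms(1)
  define V where "V = max (shannon_capacity W) (H_max W - K)"
  define S where "S = {R. 0 < R \<and> achievable W K R}"
  have upper: "R \<le> V" if "R \<in> S" for R
    using achievable_le[OF W \<open>0 < K\<close>] that by (simp add: S_def V_def)
  have lower: "R \<in> S" if "0 < R" "R < V" for R
  proof (cases "R < shannon_capacity W")
    case True
    obtain P where "P \<in> input_dists" "mutual_info P W = shannon_capacity W"
      using shannon_capacity_attained[OF W] by metis
    then show ?thesis
      using achievable_below_mutual_info[OF W] that True \<open>0 < K\<close> by (simp add: S_def)
  next
    case False
    then have "R < H_max W - K" using that by (simp add: V_def)
    moreover obtain P where "P \<in> input_dists" "entropy_fin (out_dist P W) = H_max W"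
      using H_max_attained[OF W] by metis
    ultimately show ?thesis
      using achievable_below_output_entropy[OF W] that \<open>0 < K\<close> by (simp add: S_def)
  qed
  have "0 \<le> V" using shannon_capacity_nonneg[OF W] by (simp add: V_def)
  have "(if S = {} then 0 else Sup S) = V"
  \<comment> \<open>For \<open>V = 0\<close> no positive rate is achievable, and the capacity takes
    its default value 0.\<close>
  proof (cases "V = 0")
    case True
    then have "S = {}" using upper by (force simp: S_def)
    then show ?thesis by (simp add: True)
  next
    case False
    then have "0 < V" using \<open>0 \<le> V\<close> by simp
    have "V / 2 \<in> S" using \<open>0 < V\<close> by (intro lower) auto
    have "Sup S = V"
    proof (rule cSup_eq_non_empty)
      show "S \<noteq> {}" using \<open>V / 2 \<in> S\<close> by auto
      fix b assume b: "\<And>R. R \<in> S \<Longrightarrow> R \<le> b"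
      \<comment> \<open>Achievability is known only strictly between 0 and \<open>V\<close>; by
        density this suffices for the least upper bound.\<close>
      show "V \<le> b"
      proof (rule dense_le_bounded[OF \<open>0 < V\<close>])
        fix R :: real assume "0 < R" "R < V"
        then show "R \<le> b" by (intro b lower)
      qed
    qed (rule upper)
    then show ?thesis using \<open>V / 2 \<in> S\<close> by auto
  qed
  then show ?thesis unfolding ensemble_capacity_def S_def V_def .
qed

end
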